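(* Let $I\subset S$ be a homogeneous ideal such that $V_X(I)$ is zero-dimensional of degree $\delta^+$, and let $\alpha\in\mathrm{Reg}(I)$. For each $V_X(I)$-basepoint free $\alpha_0\in\mathrm{Cl}(X)_+$ such that $\dim_{\mathbb C}\left((S/I)_{\alpha+\alpha_0}\right)=\delta^+$, the pair $(\alpha,\alpha_0)$ is a regularity pair of $I$.
   Context: $X=X_\Sigma$ is the normal toric variety over $\mathbb{C}$ of a complete rational polyhedral fan $\Sigma$ in $\mathbb{R}^n$, with rays $\rho_1,\dots,\rho_k$ and corresponding torus-invariant prime divisors $D_1,\dots,D_k$. The Cox ring is $S=\mathbb{C}[x_1,\dots,x_k]$, graded by the class group $\mathrm{Cl}(X)$ via $\deg x_i=[D_i]$, with graded pieces $S_\alpha$; $x^{\hat\sigma}=\prod_{\rho_i\notin\sigma}x_i$ and $B=\langle x^{\hat\sigma}\mid\sigma\in\Sigma\rangle$ is the irrelevant ideal. $\pi:\mathbb{C}^k\setminus\mathrm{Var}_{\mathbb{C}^k}(B)\to X$ is the Cox quotient map; for homogeneous $f$, $\mathrm{Var}_X(f)=\{\zeta\in X\mid f(x)=0\text{ for some }x\in\pi^{-1}(\zeta)\}$. A homogeneous ideal $I\subset S$ defines a closed subscheme $V_X(I)\subset X$, given on the chart $U_\sigma$ by $(I_{x^{\hat\sigma}})_0\subset(S_{x^{\hat\sigma}})_0\simeq\mathbb{C}[U_\sigma]$; $\mathrm{Var}_X(I)$ is its reduced variety. $\mathrm{Cl}(X)_+=\{[\sum_i a_iD_i]\mid a_i\ge0\}$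 is the set of effective classes. A point $\zeta\in X$ is a basepoint of $\alpha\in\mathrm{Cl}(X)$ if $\zeta\in\mathrm{Var}_X(f)$ for all $f\in S_\alpha$; $\alpha$ is $V_X(I)$-basepoint free if no point of $\mathrm{Var}_X(I)$ is a basepoint of $\alpha$ (for $V_X(I)$ zero-dimensional, equivalently some $h\in S_\alpha$ vanishes at no point of $\mathrm{Var}_X(I)$). For $V_X(I)$ zero-dimensional of degree $\delta^+$ (number of points counted with multiplicity), $\mathrm{Reg}(I)=\{\alpha\in\mathrm{Cl}(X)\mid\dim_{\mathbb C}(S/I)_\alpha=\delta^+,\ I_\alpha=(I:B^\infty)_\alpha,\ \alpha\text{ is }V_X(I)\text{-basepoint free}\}$. A pair $(\alpha,\alpha_0)\in\mathrm{Cl}(X)^2$ is a regularity pair if $\alpha,\alpha+\alpha_0\in\mathrm{Reg}(I)$ and $\alpha_0$ is $V_X(I)$-basepoint free. *)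

theory Defs
  imports
    "HOL-Analysis.Analysis"
    "HOL-Algebra.Free_Abelian_Groups"
    "HOL-Library.Poly_Mapping"
    "HOL-Computational_Algebra.Fraction_Field"
begin

section \<open>Algebraic preliminaries\<close>

subsection \<open>Ideals of a commutative ring\<close>

text \<open>An ideal is a submodule of the ring, viewed as a module over itself.\<close>

interpretation self_module: Modules.module "(*) :: 'a::comm_ring_1 \<Rightarrow> 'a \<Rightarrow> 'a"
  by unfold_locales (simp_all add: algebra_simps)

abbreviation is_ideal :: "'a::comm_ring_1 set \<Rightarrow> bool" where
  "is_ideal \<equiv> Modules.module.subspace (*)"

abbreviation ideal_generated :: "'a::comm_ring_1 set \<Rightarrow> 'a set" where
  "ideal_generated \<equiv> Modules.module.span (*)"

primrec ideal_power :: "'a::comm_ring_1 set \<Rightarrow> nat \<Rightarrow> 'a set" where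
  "ideal_power J 0 = UNIV"
| "ideal_power J (Suc N) = ideal_generated {a * b | a b. a \<in> J \<and> b \<in> ideal_power J N}"

definition ideal_saturation :: "'a::comm_ring_1 set \<Rightarrow> 'a set \<Rightarrow> 'a set" where
  "ideal_saturation I J = {f. \<exists>N. \<forall>b\<in>ideal_power J N. f * b \<in> I}"

subsection \<open>Dimension of a quotient vector space\<close>

text \<open>
  For subspaces \<open>W \<subseteq> V\<close>, \<open>quot_dim V W\<close> is the dimension of \<open>V / W\<close>: the maximal number of
  vectors of \<open>V\<close> whose residue classes modulo \<open>W\<close> are linearly independent (\<open>\<infinity>\<close> if unbounded).
\<close>

definition (in vector_space) indep_mod :: "'b set \<Rightarrow> 'b set \<Rightarrow> bool" where
  "indep_mod W F \<longleftrightarrow> (\<forall>c. (\<Sum>f\<in>F. scale (c f) f) \<in> W \<longrightarrow> (\<forall>f\<in>F. c f = 0))"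

definition (in vector_space) quot_dim :: "'b set \<Rightarrow> 'b set \<Rightarrow> enat" where
  "quot_dim V W = Sup {enat (card F) | F. finite F \<and> F \<subseteq> V \<and> indep_mod W F}"

text \<open>As expected, this is the cardinality of any finite basis of the quotient.\<close>

context vector_space
begin

lemma indep_mod_card_le:
  assumes W: "subspace W" and F: "finite F" "F \<subseteq> span (E \<union> W)" "indep_mod W F"
    and E: "finite E"
  shows "card F \<le> card E"
proof -
  have "\<exists>T. finite T \<and> T \<subseteq> W \<and> F \<subseteq> span (E \<union> T)"
    using F(1,2)
  proof (induction F)
    case empty
    then show ?case by (intro exI[of _ "{}"]) auto
  next
    case (insert x F)
    then obtain T where T: "finite T" "T \<subseteq> W" "F \<subseteq> span (E \<union> T)" by auto
    obtain S where S: "finite S" "S \<subseteq> E \<union> W" "x \<in> span S"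
      using insert.prems unfolding span_explicit
      by (smt (verit) insert_subset mem_Collect_eq subset_refl)
    have "x \<in> span (E \<union> (T \<union> (S \<inter> W)))"
      using S(2,3) span_mono[of S "E \<union> (T \<union> (S \<inter> W))"] by auto
    moreover have "F \<subseteq> span (E \<union> (T \<union> (S \<inter> W)))"
      using T(3) span_mono[of "E \<union> T" "E \<union> (T \<union> (S \<inter> W))"] by blast
    ultimately show ?case
      using T S by (intro exI[of _ "T \<union> (S \<inter> W)"]) auto
  qed
  then obtain T where T: "finite T" "T \<subseteq> W" "F \<subseteq> span (E \<union> T)" by blast
  obtain B where B: "B \<subseteq> T" "independent B" "T \<subseteq> span B"
    using maximal_independent_subset by blast
  have finB: "finite B" using B T finite_subset by blast
  have BW: "span B \<subseteq> W" using B T W by (meson order_trans span_minimal)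
  have ind0: "\<forall>b\<in>B. u b = 0" if "(\<Sum>b\<in>B. scale (u b) b) = 0" for u
    using B(2) finB that independent_explicit_finite_subsets by blast
  have disj: "F \<inter> B = {}"
  proof (rule ccontr)
    assume "F \<inter> B \<noteq> {}"
    then obtain x where x: "x \<in> F" "x \<in> B" by blast
    have "(\<Sum>f\<in>F. scale (if f = x then 1 else 0) f) = x"
    proof -
      have "(\<Sum>f\<in>F. scale (if f = x then 1 else 0) f) = (\<Sum>f\<in>F. if f = x then f else 0)"
        by (rule sum.cong) auto
      then show ?thesis using x F(1) by simp
    qed
    moreover have "x \<in> W" using x B T by blast
    ultimately show False
      using F(3)[unfolded indep_mod_def, rule_format, of "\<lambda>f. if f = x then 1 else 0" x] x(1)
      by simp
  qed
  have indep: "independent (F \<union> B)"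
  proof (rule independent_if_scalars_zero)
    show "finite (F \<union> B)" using F(1) finB by simp
    fix c x
    assume s: "(\<Sum>x\<in>F \<union> B. scale (c x) x) = 0" and x: "x \<in> F \<union> B"
    have e: "(\<Sum>x\<in>F. scale (c x) x) + (\<Sum>x\<in>B. scale (c x) x) = 0"
      using s disj F(1) finB by (simp add: sum.union_disjoint)
    have "(\<Sum>x\<in>B. scale (c x) x) \<in> W"
      using BW by (meson span_base span_scale span_sum subsetD)
    then have "(\<Sum>x\<in>F. scale (c x) x) \<in> W"
      using e W by (metis eq_neg_iff_add_eq_0 subspace_neg)
    then have F0: "\<forall>f\<in>F. c f = 0" using F(3) unfolding indep_mod_def by blast
    then have "(\<Sum>x\<in>B. scale (c x) x) = 0" using e by simp
    then show "c x = 0" using F0 ind0 x by blast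
  qed
  have sub: "F \<union> B \<subseteq> span (E \<union> B)"
  proof -
    have "T \<subseteq> span (E \<union> B)" using B(3) span_mono[of B "E \<union> B"] by blast
    moreover have "E \<subseteq> span (E \<union> B)" using span_superset by blast
    ultimately have "span (E \<union> T) \<subseteq> span (E \<union> B)"
      by (simp add: span_minimal)
    then show ?thesis using T(3) span_superset by blast
  qed
  have "card (F \<union> B) \<le> card (E \<union> B)"
    using independent_span_bound[OF _ indep sub] E finB by simp
  also have "\<dots> \<le> card E + card B" by (rule card_Un_le)
  finally show ?thesis
    using card_Un_disjoint[OF F(1) finB disj] by simp
qed

lemma quot_dim_eq_card_basis:
  assumes "subspace W" "finite E" "E \<subseteq> V" "indep_mod W E" "V \<subseteq> span (E \<union> W)"
  shows "quot_dim V W = enat (card E)"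
  unfolding quot_dim_def
proof (rule antisym)
  show "Sup {enat (card F) |F. finite F \<and> F \<subseteq> V \<and> indep_mod W F} \<le> enat (card E)"
    using assms indep_mod_card_le by (intro Sup_least) (auto intro: order_trans)
  show "enat (card E) \<le> Sup {enat (card F) |F. finite F \<and> F \<subseteq> V \<and> indep_mod W F}"
    using assms by (intro Sup_upper) blast
qed

end

section \<open>Lattices and fans\<close>

text \<open>
  Both lattices \<open>N\<close> (containing the ray generators) and \<open>M\<close> (the characters) are \<open>\<int>\<^sup>n\<close>, with
  the standard pairing. They are represented by finitely supported functions on the finite
  index type, because that type carries the (lexicographic) group order which makes the group
  algebra of \<open>M\<close> an integral domain in the type class hierarchy.
\<close>

type_synonym 'n lattice = "'n \<Rightarrow>\<^sub>0 int"

definition pairing :: "'n::finite lattice \<Rightarrow> 'n lattice \<Rightarrow> int" where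
  "pairing m v = (\<Sum>j\<in>UNIV. Poly_Mapping.lookup m j * Poly_Mapping.lookup v j)"

definition real_point :: "'n::finite lattice \<Rightarrow> real ^ 'n" where
  "real_point v = (\<chi> j. real_of_int (Poly_Mapping.lookup v j))"

definition rational_polyhedral_cone :: "(real ^ 'n::finite) set \<Rightarrow> bool" where
  "rational_polyhedral_cone \<sigma> \<longleftrightarrow>
     (\<exists>F :: 'n lattice set. finite F \<and> \<sigma> = convex_cone hull (real_point ` F))"

definition strongly_convex :: "(real ^ 'n::finite) set \<Rightarrow> bool" where
  "strongly_convex \<sigma> \<longleftrightarrow> \<sigma> \<inter> uminus ` \<sigma> = {0}"

text \<open>The library's \<open>face_of\<close> admits the empty set as a face, which is not a face of a cone.\<close>

definition cone_face :: "(real ^ 'n::finite) set \<Rightarrow> (real ^ 'n) set \<Rightarrow> bool" where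
  "cone_face \<tau> \<sigma> \<longleftrightarrow> \<tau> face_of \<sigma> \<and> \<tau> \<noteq> {}"

definition fan :: "(real ^ 'n::finite) set set \<Rightarrow> bool" where
  "fan \<Sigma> \<longleftrightarrow>
     finite \<Sigma> \<and>
     (\<forall>\<sigma>\<in>\<Sigma>. rational_polyhedral_cone \<sigma> \<and> strongly_convex \<sigma>) \<and>
     (\<forall>\<sigma>\<in>\<Sigma>. \<forall>\<tau>. cone_face \<tau> \<sigma> \<longrightarrow> \<tau> \<in> \<Sigma>) \<and>
     (\<forall>\<sigma>\<in>\<Sigma>. \<forall>\<sigma>'\<in>\<Sigma>. cone_face (\<sigma> \<inter> \<sigma>') \<sigma> \<and> cone_face (\<sigma> \<inter> \<sigma>') \<sigma>')"

definition complete_fan :: "(real ^ 'n::finite) set set \<Rightarrow> bool" where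
  "complete_fan \<Sigma> \<longleftrightarrow> fan \<Sigma> \<and> \<Union>\<Sigma> = UNIV"

definition primitive :: "'n lattice \<Rightarrow> bool" where
  "primitive v \<longleftrightarrow> (\<forall>c w. v = frag_cmul c w \<longrightarrow> \<bar>c\<bar> = 1)"

text \<open>\<open>u\<close> enumerates, without repetition, the primitive generators of the rays of the fan.\<close>

definition ray_generators ::
  "(real ^ 'n::finite) set set \<Rightarrow> ('k \<Rightarrow> 'n lattice) \<Rightarrow> bool" where
  "ray_generators \<Sigma> u \<longleftrightarrow>
     (\<forall>i. primitive (u i)) \<and>
     bij_betw (\<lambda>i. convex_cone hull {real_point (u i)}) UNIV {\<rho> \<in> \<Sigma>. dim \<rho> = 1}"

definition cone_rays :: "('k \<Rightarrow> 'n::finite lattice) \<Rightarrow> (real ^ 'n) set \<Rightarrow> 'k set" where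
  "cone_rays u \<sigma> = {i. real_point (u i) \<in> \<sigma>}"

section \<open>The class group and the Cox ring\<close>

subsection \<open>The class group\<close>

text \<open>
  \<open>Cl(X)\<close> is the group of torus-invariant divisors \<open>\<Sum> a\<^sub>i D\<^sub>i\<close> modulo the divisors
  \<open>div(\<chi>\<^sup>m) = \<Sum> \<langle>m, u\<^sub>i\<rangle> D\<^sub>i\<close> of characters.
\<close>

definition char_divisor ::
  "('k::finite \<Rightarrow> 'n::finite lattice) \<Rightarrow> 'n lattice \<Rightarrow> ('k \<Rightarrow>\<^sub>0 int)" where
  "char_divisor u m = (\<Sum>i\<in>UNIV. Poly_Mapping.single i (pairing m (u i)))"

definition class_group ::
  "('k::finite \<Rightarrow> 'n::finite lattice) \<Rightarrow> ('k \<Rightarrow>\<^sub>0 int) set monoid" where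
  "class_group u = free_Abelian_group UNIV Mod (char_divisor u ` UNIV)"

definition divisor_class ::
  "('k::finite \<Rightarrow> 'n::finite lattice) \<Rightarrow> ('k \<Rightarrow>\<^sub>0 int) \<Rightarrow> ('k \<Rightarrow>\<^sub>0 int) set" where
  "divisor_class u D = (char_divisor u ` UNIV) #>\<^bsub>free_Abelian_group UNIV\<^esub> D"

definition effective_classes ::
  "('k::finite \<Rightarrow> 'n::finite lattice) \<Rightarrow> ('k \<Rightarrow>\<^sub>0 int) set set" where
  "effective_classes u = {divisor_class u D | D. \<forall>i. 0 \<le> Poly_Mapping.lookup D i}"

subsection \<open>The Cox ring\<close>

text \<open>The Cox ring is the polynomial ring over \<open>\<complex>\<close> with variables indexed by the rays.\<close>

type_synonym 'k cox = "('k \<Rightarrow>\<^sub>0 nat) \<Rightarrow>\<^sub>0 complex"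

definition cox_var :: "'k \<Rightarrow> 'k cox" where
  "cox_var i = Poly_Mapping.single (Poly_Mapping.single i 1) 1"

definition cox_scale :: "complex \<Rightarrow> 'k cox \<Rightarrow> 'k cox" where
  "cox_scale c f = Poly_Mapping.single 0 c * f"

interpretation cox: vector_space "cox_scale :: complex \<Rightarrow> 'k cox \<Rightarrow> 'k cox"
proof unfold_locales
  fix a b :: complex and x y :: "'k cox"
  show "cox_scale a (x + y) = cox_scale a x + cox_scale a y"
    by (simp add: cox_scale_def distrib_left)
  show "cox_scale (a + b) x = cox_scale a x + cox_scale b x"
    by (simp add: cox_scale_def single_add distrib_right)
  show "cox_scale a (cox_scale b x) = cox_scale (a * b) x"
    by (simp add: cox_scale_def mult_single flip: mult.assoc)
  show "cox_scale 1 x = x"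
    by (simp add: cox_scale_def)
qed

definition cox_eval :: "'k::finite cox \<Rightarrow> complex ^ 'k \<Rightarrow> complex" where
  "cox_eval f x = (\<Sum>a\<in>Poly_Mapping.keys f.
     Poly_Mapping.lookup f a * (\<Prod>i\<in>UNIV. (x $ i) ^ Poly_Mapping.lookup a i))"

definition monomial_degree ::
  "('k::finite \<Rightarrow> 'n::finite lattice) \<Rightarrow> ('k \<Rightarrow>\<^sub>0 nat) \<Rightarrow> ('k \<Rightarrow>\<^sub>0 int) set" where
  "monomial_degree u a =
     divisor_class u (\<Sum>i\<in>UNIV. Poly_Mapping.single i (int (Poly_Mapping.lookup a i)))"

definition graded_piece ::
  "('k::finite \<Rightarrow> 'n::finite lattice) \<Rightarrow> ('k \<Rightarrow>\<^sub>0 int) set \<Rightarrow> 'k cox set" where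
  "graded_piece u \<alpha> = {f. \<forall>a\<in>Poly_Mapping.keys f. monomial_degree u a = \<alpha>}"

definition homogeneous_ideal ::
  "('k::finite \<Rightarrow> 'n::finite lattice) \<Rightarrow> 'k cox set \<Rightarrow> bool" where
  "homogeneous_ideal u I \<longleftrightarrow>
     is_ideal I \<and>
     (\<exists>G \<subseteq> (\<Union>\<alpha>\<in>carrier (class_group u). graded_piece u \<alpha>). I = ideal_generated G)"

text \<open>\<open>dim\<^sub>\<complex> (S/I)\<^sub>\<alpha>\<close>, where \<open>(S/I)\<^sub>\<alpha> = S\<^sub>\<alpha> / I\<^sub>\<alpha>\<close> and \<open>I\<^sub>\<alpha> = I \<inter> S\<^sub>\<alpha>\<close>.\<close>

definition hilbert_function ::
  "('k::finite \<Rightarrow> 'n::finite lattice) \<Rightarrow> 'k cox set \<Rightarrow> ('k \<Rightarrow>\<^sub>0 int) set \<Rightarrow> enat" where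
  "hilbert_function u I \<alpha> = cox.quot_dim (graded_piece u \<alpha>) (I \<inter> graded_piece u \<alpha>)"

definition cone_monomial ::
  "('k::finite \<Rightarrow> 'n::finite lattice) \<Rightarrow> (real ^ 'n) set \<Rightarrow> 'k cox" where
  "cone_monomial u \<sigma> = (\<Prod>i\<in>- cone_rays u \<sigma>. cox_var i)"

definition irrelevant_ideal ::
  "(real ^ 'n::finite) set set \<Rightarrow> ('k::finite \<Rightarrow> 'n lattice) \<Rightarrow> 'k cox set" where
  "irrelevant_ideal \<Sigma> u = ideal_generated (cone_monomial u ` \<Sigma>)"

section \<open>The toric variety and the Cox quotient map\<close>

text \<open>
  The affine toric variety \<open>U\<^sub>\<sigma> = Spec \<complex>[\<sigma>\<^sup>\<or> \<inter> M]\<close> enters through its coordinate ring, a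
  subring of the group algebra of \<open>M\<close>, and its (closed) points, the monoid homomorphisms from
  \<open>\<sigma>\<^sup>\<or> \<inter> M\<close> to \<open>(\<complex>, \<cdot>)\<close>.
\<close>

definition dual_monoid :: "(real ^ 'n::finite) set \<Rightarrow> 'n lattice set" where
  "dual_monoid \<sigma> = {m. \<forall>v\<in>\<sigma>. 0 \<le> real_point m \<bullet> v}"

type_synonym 'n laurent = "'n lattice \<Rightarrow>\<^sub>0 complex"

definition coord_ring :: "(real ^ 'n::finite) set \<Rightarrow> 'n laurent set" where
  "coord_ring \<sigma> = {g. Poly_Mapping.keys g \<subseteq> dual_monoid \<sigma>}"

definition chart_points :: "(real ^ 'n::finite) set \<Rightarrow> ('n lattice \<Rightarrow> complex) set" where
  "chart_points \<sigma> = {\<gamma> \<in> extensional (dual_monoid \<sigma>).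
     \<gamma> 0 = 1 \<and> (\<forall>m\<in>dual_monoid \<sigma>. \<forall>m'\<in>dual_monoid \<sigma>. \<gamma> (m + m') = \<gamma> m * \<gamma> m')}"

definition chart_eval :: "'n laurent \<Rightarrow> ('n lattice \<Rightarrow> complex) \<Rightarrow> complex" where
  "chart_eval g \<gamma> = (\<Sum>m\<in>Poly_Mapping.keys g. Poly_Mapping.lookup g m * \<gamma> m)"

text \<open>
  The points of \<open>X\<close> are obtained from the disjoint union of the charts by gluing along the open
  immersions \<open>U\<^sub>\<tau> \<subseteq> U\<^sub>\<sigma>\<close> for faces \<open>\<tau>\<close> of \<open>\<sigma>\<close>, which restrict a homomorphism to
  \<open>\<sigma>\<^sup>\<or> \<inter> M \<subseteq> \<tau>\<^sup>\<or> \<inter> M\<close>. A point of \<open>X\<close> is thus the set of its representatives \<open>(\<sigma>, \<gamma>)\<close> with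
  \<open>\<gamma> \<in> U\<^sub>\<sigma>\<close>.
\<close>

type_synonym 'n chart_point = "(real ^ 'n) set \<times> ('n lattice \<Rightarrow> complex)"

definition face_immersions ::
  "(real ^ 'n::finite) set set \<Rightarrow> ('n chart_point \<times> 'n chart_point) set" where
  "face_immersions \<Sigma> =
     {((\<tau>, \<delta>), (\<sigma>, restrict \<delta> (dual_monoid \<sigma>))) | \<tau> \<sigma> \<delta>.
        \<tau> \<in> \<Sigma> \<and> \<sigma> \<in> \<Sigma> \<and> cone_face \<tau> \<sigma> \<and> \<delta> \<in> chart_points \<tau>}"

definition gluing ::
  "(real ^ 'n::finite) set set \<Rightarrow> ('n chart_point \<times> 'n chart_point) set" where
  "gluing \<Sigma> = (face_immersions \<Sigma> \<union> (face_immersions \<Sigma>)\<inverse>)\<^sup>*"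

definition toric_variety :: "(real ^ 'n::finite) set set \<Rightarrow> 'n chart_point set set" where
  "toric_variety \<Sigma> = (SIGMA \<sigma>:\<Sigma>. chart_points \<sigma>) // gluing \<Sigma>"

definition chart_incl ::
  "(real ^ 'n::finite) set set \<Rightarrow> (real ^ 'n) set \<Rightarrow> ('n lattice \<Rightarrow> complex) \<Rightarrow>
     'n chart_point set" where
  "chart_incl \<Sigma> \<sigma> \<gamma> = gluing \<Sigma> `` {(\<sigma>, \<gamma>)}"

text \<open>
  The Cox quotient map \<open>\<pi>\<close> is the toric morphism induced by \<open>e\<^sub>i \<mapsto> u\<^sub>i\<close>. On the part where
  \<open>x\<^sup>\<sigma>\<close> does not vanish it takes values in \<open>U\<^sub>\<sigma>\<close>, with
  \<open>\<chi>\<^sup>m(\<pi>(x)) = \<Prod> x\<^sub>i\<^bsup>\<langle>m, u\<^sub>i\<rangle>\<^esup>\<close>; its value does not depend on the choice of \<open>\<sigma>\<close>.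
\<close>

definition irrelevant_locus ::
  "(real ^ 'n::finite) set set \<Rightarrow> ('k::finite \<Rightarrow> 'n lattice) \<Rightarrow> (complex ^ 'k) set" where
  "irrelevant_locus \<Sigma> u = {x. \<forall>b\<in>irrelevant_ideal \<Sigma> u. cox_eval b x = 0}"

definition cox_map_chart ::
  "('k::finite \<Rightarrow> 'n::finite lattice) \<Rightarrow> (real ^ 'n) set \<Rightarrow> complex ^ 'k \<Rightarrow>
     'n lattice \<Rightarrow> complex" where
  "cox_map_chart u \<sigma> x = (\<lambda>m\<in>dual_monoid \<sigma>. \<Prod>i\<in>UNIV. (x $ i) powi (pairing m (u i)))"

definition cox_map ::
  "(real ^ 'n::finite) set set \<Rightarrow> ('k::finite \<Rightarrow> 'n lattice) \<Rightarrow> complex ^ 'k \<Rightarrow>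
     'n chart_point set" where
  "cox_map \<Sigma> u x =
     (let \<sigma> = (SOME \<sigma>. \<sigma> \<in> \<Sigma> \<and> cox_eval (cone_monomial u \<sigma>) x \<noteq> 0)
      in chart_incl \<Sigma> \<sigma> (cox_map_chart u \<sigma> x))"

definition cox_fiber ::
  "(real ^ 'n::finite) set set \<Rightarrow> ('k::finite \<Rightarrow> 'n lattice) \<Rightarrow> 'n chart_point set \<Rightarrow>
     (complex ^ 'k) set" where
  "cox_fiber \<Sigma> u \<zeta> = {x. x \<notin> irrelevant_locus \<Sigma> u \<and> cox_map \<Sigma> u x = \<zeta>}"

definition var_of_section ::
  "(real ^ 'n::finite) set set \<Rightarrow> ('k::finite \<Rightarrow> 'n lattice) \<Rightarrow> 'k cox \<Rightarrow>
     'n chart_point set set" where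
  "var_of_section \<Sigma> u f =
     {\<zeta> \<in> toric_variety \<Sigma>. \<exists>x\<in>cox_fiber \<Sigma> u \<zeta>. cox_eval f x = 0}"

section \<open>The subscheme defined by a homogeneous ideal\<close>

text \<open>
  The isomorphism \<open>\<complex>[\<sigma>\<^sup>\<or> \<inter> M] \<simeq> (S\<^bsub>x\<^sup>\<sigma>\<^esub>)\<^sub>0\<close> sends \<open>\<chi>\<^sup>m\<close> to \<open>\<Prod> x\<^sub>i\<^bsup>\<langle>m, u\<^sub>i\<rangle>\<^esup>\<close>. All localizations of
  \<open>S\<close> are formed inside its field of fractions.
\<close>

definition homogenize ::
  "('k::{finite,linorder} \<Rightarrow> 'n::finite lattice) \<Rightarrow> 'n laurent \<Rightarrow> 'k cox fract" where
  "homogenize u g =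
     (\<Sum>m\<in>Poly_Mapping.keys g. Fract (Poly_Mapping.single 0 (Poly_Mapping.lookup g m)) 1 *
        (\<Prod>i\<in>UNIV. (Fract (cox_var i) 1) powi (pairing m (u i))))"

definition localized_ideal ::
  "('k::{finite,linorder} \<Rightarrow> 'n::finite lattice) \<Rightarrow> (real ^ 'n) set \<Rightarrow> 'k cox set \<Rightarrow>
     'k cox fract set" where
  "localized_ideal u \<sigma> I = {Fract f (cone_monomial u \<sigma> ^ N) | f N. f \<in> I}"

text \<open>The ideal of \<open>V\<^sub>X(I) \<inter> U\<^sub>\<sigma>\<close>, that is \<open>(I\<^bsub>x\<^sup>\<sigma>\<^esub>)\<^sub>0\<close> transported to \<open>\<complex>[\<sigma>\<^sup>\<or> \<inter> M]\<close>.\<close>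

definition chart_ideal ::
  "('k::{finite,linorder} \<Rightarrow> 'n::finite lattice) \<Rightarrow> (real ^ 'n) set \<Rightarrow> 'k cox set \<Rightarrow>
     'n laurent set" where
  "chart_ideal u \<sigma> I = {g \<in> coord_ring \<sigma>. homogenize u g \<in> localized_ideal u \<sigma> I}"

definition var_of_ideal ::
  "(real ^ 'n::finite) set set \<Rightarrow> ('k::{finite,linorder} \<Rightarrow> 'n lattice) \<Rightarrow> 'k cox set \<Rightarrow>
     'n chart_point set set" where
  "var_of_ideal \<Sigma> u I =
     {\<zeta> \<in> toric_variety \<Sigma>.
        \<exists>(\<sigma>, \<gamma>)\<in>\<zeta>. \<forall>g\<in>chart_ideal u \<sigma> I. chart_eval g \<gamma> = 0}"

subsection \<open>Dimension\<close>

definition zariski_closed ::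
  "(real ^ 'n::finite) set set \<Rightarrow> 'n chart_point set set \<Rightarrow> bool" where
  "zariski_closed \<Sigma> Z \<longleftrightarrow>
     Z \<subseteq> toric_variety \<Sigma> \<and>
     (\<forall>\<sigma>\<in>\<Sigma>. \<exists>G\<subseteq>coord_ring \<sigma>.
        {\<gamma> \<in> chart_points \<sigma>. chart_incl \<Sigma> \<sigma> \<gamma> \<in> Z} =
        {\<gamma> \<in> chart_points \<sigma>. \<forall>g\<in>G. chart_eval g \<gamma> = 0})"

definition irreducible_closed ::
  "(real ^ 'n::finite) set set \<Rightarrow> 'n chart_point set set \<Rightarrow> bool" where
  "irreducible_closed \<Sigma> Z \<longleftrightarrow>
     zariski_closed \<Sigma> Z \<and> Z \<noteq> {} \<and>
     (\<forall>Z1 Z2. zariski_closed \<Sigma> Z1 \<and> zariski_closed \<Sigma> Z2 \<and> Z = Z1 \<union> Z2 \<longrightarrow>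
        Z = Z1 \<or> Z = Z2)"

text \<open>
  Krull dimension of a closed subset. The supremum is taken in \<^typ>\<open>enat\<close>, so that it is 0 for the
  empty set, which has to be excluded separately.
\<close>

definition krull_dim ::
  "(real ^ 'n::finite) set set \<Rightarrow> 'n chart_point set set \<Rightarrow> enat" where
  "krull_dim \<Sigma> V =
     Sup {enat d | d. \<exists>Z. (\<forall>j\<le>d. irreducible_closed \<Sigma> (Z j) \<and> Z j \<subseteq> V) \<and>
                          (\<forall>j<d. Z j \<subset> Z (Suc j))}"

definition zero_dimensional ::
  "(real ^ 'n::finite) set set \<Rightarrow> ('k::{finite,linorder} \<Rightarrow> 'n lattice) \<Rightarrow>
     'k cox set \<Rightarrow> bool" where
  "zero_dimensional \<Sigma> u I \<longleftrightarrow>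
     var_of_ideal \<Sigma> u I \<noteq> {} \<and> krull_dim \<Sigma> (var_of_ideal \<Sigma> u I) = 0"

subsection \<open>Multiplicity and degree\<close>

text \<open>
  The local ring \<open>O\<^bsub>X,\<zeta>\<^esub>\<close> is realized inside the field of fractions of the group algebra of \<open>M\<close>;
  there, the representatives of \<open>\<zeta>\<close> on the different charts all define the same ring, and the
  same extended ideal \<open>I\<^sub>\<sigma> O\<^bsub>X,\<zeta>\<^esub>\<close>.
\<close>

definition fract_scale ::
  "complex \<Rightarrow> 'n::{finite,linorder} laurent fract \<Rightarrow> 'n laurent fract" where
  "fract_scale c q = Fract (Poly_Mapping.single 0 c) 1 * q"

interpretation laurent_fract: vector_space
  "fract_scale :: complex \<Rightarrow> 'n::{finite,linorder} laurent fract \<Rightarrow> 'n laurent fract"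
proof unfold_locales
  fix a b :: complex and x y :: "'n laurent fract"
  show "fract_scale a (x + y) = fract_scale a x + fract_scale a y"
    by (simp add: fract_scale_def algebra_simps)
  have "Fract (Poly_Mapping.single 0 (a + b)) 1 =
      (Fract (Poly_Mapping.single 0 a) 1 + Fract (Poly_Mapping.single 0 b) 1 :: 'n laurent fract)"
    by (subst add_fract) (simp_all add: single_add)
  then show "fract_scale (a + b) x = fract_scale a x + fract_scale b x"
    by (simp only: fract_scale_def distrib_right)
  have "Fract (Poly_Mapping.single 0 a) 1 * Fract (Poly_Mapping.single 0 b) 1 =
      (Fract (Poly_Mapping.single 0 (a * b)) 1 :: 'n laurent fract)"
    by (simp add: mult_single)
  then show "fract_scale a (fract_scale b x) = fract_scale (a * b) x"
    by (simp add: fract_scale_def flip: mult.assoc)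
  show "fract_scale 1 x = x"
    by (simp add: fract_scale_def One_fract_def[symmetric])
qed

definition local_ring ::
  "'n::{finite,linorder} chart_point set \<Rightarrow> 'n laurent fract set" where
  "local_ring \<zeta> =
     {Fract g s | g s \<sigma> \<gamma>. (\<sigma>, \<gamma>) \<in> \<zeta> \<and> g \<in> coord_ring \<sigma> \<and> s \<in> coord_ring \<sigma> \<and>
        chart_eval s \<gamma> \<noteq> 0}"

definition local_ideal ::
  "('k::{finite,linorder} \<Rightarrow> 'n::{finite,linorder} lattice) \<Rightarrow> 'k cox set \<Rightarrow>
     'n chart_point set \<Rightarrow> 'n laurent fract set" where
  "local_ideal u I \<zeta> =
     {Fract g s | g s \<sigma> \<gamma>. (\<sigma>, \<gamma>) \<in> \<zeta> \<and> g \<in> chart_ideal u \<sigma> I \<and> s \<in> coord_ring \<sigma> \<and>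
        chart_eval s \<gamma> \<noteq> 0}"

text \<open>The multiplicity of \<open>\<zeta>\<close> is the dimension of the local ring of \<open>V\<^sub>X(I)\<close> at \<open>\<zeta>\<close>.\<close>

definition multiplicity_at ::
  "('k::{finite,linorder} \<Rightarrow> 'n::{finite,linorder} lattice) \<Rightarrow> 'k cox set \<Rightarrow>
     'n chart_point set \<Rightarrow> enat" where
  "multiplicity_at u I \<zeta> = laurent_fract.quot_dim (local_ring \<zeta>) (local_ideal u I \<zeta>)"

definition scheme_degree ::
  "(real ^ 'n::{finite,linorder}) set set \<Rightarrow> ('k::{finite,linorder} \<Rightarrow> 'n lattice) \<Rightarrow>
     'k cox set \<Rightarrow> enat" where
  "scheme_degree \<Sigma> u I = (\<Sum>\<^sub>\<infinity>\<zeta>\<in>var_of_ideal \<Sigma> u I. multiplicity_at u I \<zeta>)"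

section \<open>Basepoints and regularity\<close>

definition basepoint ::
  "(real ^ 'n::finite) set set \<Rightarrow> ('k::finite \<Rightarrow> 'n lattice) \<Rightarrow> ('k \<Rightarrow>\<^sub>0 int) set \<Rightarrow>
     'n chart_point set \<Rightarrow> bool" where
  "basepoint \<Sigma> u \<alpha> \<zeta> \<longleftrightarrow>
     \<zeta> \<in> toric_variety \<Sigma> \<and> (\<forall>f\<in>graded_piece u \<alpha>. \<zeta> \<in> var_of_section \<Sigma> u f)"

definition basepoint_free ::
  "(real ^ 'n::finite) set set \<Rightarrow> ('k::{finite,linorder} \<Rightarrow> 'n lattice) \<Rightarrow> 'k cox set \<Rightarrow>
     ('k \<Rightarrow>\<^sub>0 int) set \<Rightarrow> bool" where
  "basepoint_free \<Sigma> u I \<alpha> \<longleftrightarrow> (\<forall>\<zeta>\<in>var_of_ideal \<Sigma> u I. \<not> basepoint \<Sigma> u \<alpha> \<zeta>)"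

definition regularity ::
  "(real ^ 'n::{finite,linorder}) set set \<Rightarrow> ('k::{finite,linorder} \<Rightarrow> 'n lattice) \<Rightarrow>
     'k cox set \<Rightarrow> ('k \<Rightarrow>\<^sub>0 int) set set" where
  "regularity \<Sigma> u I =
     {\<alpha> \<in> carrier (class_group u).
        hilbert_function u I \<alpha> = scheme_degree \<Sigma> u I \<and>
        I \<inter> graded_piece u \<alpha> =
          ideal_saturation I (irrelevant_ideal \<Sigma> u) \<inter> graded_piece u \<alpha> \<and>
        basepoint_free \<Sigma> u I \<alpha>}"

definition regularity_pair ::
  "(real ^ 'n::{finite,linorder}) set set \<Rightarrow> ('k::{finite,linorder} \<Rightarrow> 'n lattice) \<Rightarrow>
     'k cox set \<Rightarrow> ('k \<Rightarrow>\<^sub>0 int) set \<Rightarrow> ('k \<Rightarrow>\<^sub>0 int) set \<Rightarrow> bool" where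
  "regularity_pair \<Sigma> u I \<alpha> \<alpha>\<^sub>0 \<longleftrightarrow>
     \<alpha> \<in> carrier (class_group u) \<and> \<alpha>\<^sub>0 \<in> carrier (class_group u) \<and>
     \<alpha> \<in> regularity \<Sigma> u I \<and> \<alpha> \<otimes>\<^bsub>class_group u\<^esub> \<alpha>\<^sub>0 \<in> regularity \<Sigma> u I \<and>
     basepoint_free \<Sigma> u I \<alpha>\<^sub>0"

end

theory Submission
  imports Defs "HOL-Computational_Algebra.Fundamental_Theorem_Algebra"
begin

text \<open>
  Write \<open>J\<close> for the saturation \<open>(I : B\<^sup>\<infinity>)\<close>. Multiplication by \<open>h \<in> S\<close> is injective on \<open>S / J\<close> as soon
  as \<open>h\<close> avoids the maximal ideals among the quotients \<open>(J : f)\<close> with \<open>f \<notin> J\<close>. Since \<open>S\<close> is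
  Noetherian there are finitely many of these, they are prime, and none contains \<open>B\<close>. By the
  Nullstellensatz each of them therefore vanishes at a point of \<open>Var(I) \<setminus> Var(B)\<close>. This point
  lies over a point of \<open>Var\<^sub>X(I)\<close>, where \<open>\<alpha>\<^sub>0\<close> has a nonvanishing section. So the elements of
  degree \<open>\<alpha>\<^sub>0\<close> in each of these primes form a proper subspace, and over an infinite field some \<open>h\<close>
  of degree \<open>\<alpha>\<^sub>0\<close> avoids them all. It embeds \<open>(S / J)\<^sub>\<alpha>\<close>, of dimension \<open>\<delta>\<close>, into the quotient
  \<open>(S / J)\<^bsub>\<alpha> + \<alpha>\<^sub>0\<^esub>\<close> of the \<open>\<delta>\<close>-dimensional space \<open>(S / I)\<^bsub>\<alpha> + \<alpha>\<^sub>0\<^esub>\<close>. Hence \<open>I\<close> and \<open>J\<close> agree in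
  degree \<open>\<alpha> + \<alpha>\<^sub>0\<close>, and that degree is basepoint free because products of sections are sections.
\<close>

(* As a simp rule for multiplication this is the converse of mult.assoc, so that the two loop. *)
declare self_module.scale_scale [simp del]

section \<open>The Cox ring is Noetherian\<close>

lemma incseq_subsequence_nat:
  fixes f :: "nat \<Rightarrow> nat"
  obtains r where "strict_mono r" "incseq (f \<circ> r)"
proof -
  obtain r where r: "strict_mono r" "monoseq (\<lambda>n. f (r n))"
    using seq_monosub[of f] by blast
  show thesis
  proof (cases "incseq (\<lambda>n. f (r n))")
    case True
    then show ?thesis using that[of r] r(1) by (simp add: o_def)
  next
    case False
    then have dec: "decseq (\<lambda>n. f (r n))"
      using r(2) by (simp add: monoseq_iff)
    \<comment> \<open>A decreasing sequence of naturals is constant once it attains its minimum;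
      that tail is the subsequence.\<close>
    obtain N where N: "\<And>n. f (r N) \<le> f (r n)"
      using ex_has_least_nat[of "\<lambda>_. True" 0 "\<lambda>n. f (r n)"] by auto
    have const: "f (r (n + N)) = f (r N)" for n
      using N[of "n + N"] decseqD[OF dec, of N "n + N"] by simp
    show ?thesis
    proof (rule that[of "\<lambda>n. r (n + N)"])
      show "strict_mono (\<lambda>n. r (n + N))"
        using r(1) by (simp add: strict_mono_def)
      show "incseq (f \<circ> (\<lambda>n. r (n + N)))"
        by (simp add: incseq_def const)
    qed
  qed
qed

text \<open>Refining the sequence for one variable after another makes all exponents nondecreasing
  at once. In such a subsequence an earlier monomial divides a later one.\<close>

lemma dickson:
  fixes a :: "nat \<Rightarrow> ('k::finite \<Rightarrow>\<^sub>0 nat)"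
  obtains i j c where "i < j" "a j = a i + c"
proof -
  have "\<exists>r. strict_mono r \<and> (\<forall>k\<in>K. incseq (\<lambda>n. Poly_Mapping.lookup (a (r n)) k))"
    if "finite K" for K :: "'k set"
    using that
  proof (induction K)
    case empty
    show ?case by (intro exI[of _ id]) (auto simp: strict_mono_def)
  next
    case (insert k K)
    then obtain r where r: "strict_mono r"
      "\<And>k. k \<in> K \<Longrightarrow> incseq (\<lambda>n. Poly_Mapping.lookup (a (r n)) k)" by blast
    obtain s where s: "strict_mono s" "incseq ((\<lambda>n. Poly_Mapping.lookup (a (r n)) k) \<circ> s)"
      using incseq_subsequence_nat by blast
    have "incseq (\<lambda>n. Poly_Mapping.lookup (a ((r \<circ> s) n)) l)" if "l \<in> K" for l
      using r(2)[OF that] s(1) by (simp add: incseq_def strict_mono_less_eq)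
    moreover have "strict_mono (r \<circ> s)" using r(1) s(1) by (rule strict_mono_o)
    ultimately show ?case using s(2) by (intro exI[of _ "r \<circ> s"]) (auto simp: o_def)
  qed
  from this[of UNIV] obtain r where r: "strict_mono r"
    "\<And>k. incseq (\<lambda>n. Poly_Mapping.lookup (a (r n)) k)" by auto
  have "a (r 1) = a (r 0) + (a (r 1) - a (r 0))"
    using r(2) by (intro poly_mapping_eqI) (simp add: lookup_add lookup_minus incseq_def)
  moreover have "r 0 < r 1" using r(1) by (simp add: strict_mono_def)
  ultimately show thesis using that by blast
qed

text \<open>The order is lexicographic and a natural exponent is never below 0, so a monomial never
  exceeds its multiples.\<close>

lemma monomial_le_add:
  fixes a c :: "'k::linorder \<Rightarrow>\<^sub>0 nat"
  shows "a \<le> a + c"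
proof -
  have "\<not> c < 0"
    by (simp add: less_poly_mapping.rep_eq less_fun_def)
  then show ?thesis by (simp add: add_increasing2)
qed

text \<open>By Dickson's lemma an infinite descent would contain a later monomial divisible by an
  earlier one, hence not below it.\<close>

lemma wfp_monomial_less: "wfp ((<) :: ('k::{finite,linorder} \<Rightarrow>\<^sub>0 nat) \<Rightarrow> _)"
proof -
  have False if d: "\<And>i. a (Suc i) < a i" for a :: "nat \<Rightarrow> ('k \<Rightarrow>\<^sub>0 nat)"
  proof -
    obtain i j c where "i < j" "a j = a i + c" using dickson by blast
    moreover have "a (i + Suc n) < a i" for n
      by (induction n) (use d in \<open>auto intro: less_trans\<close>)
    ultimately show False
      by (metis less_imp_Suc_add add_Suc_right monomial_le_add leD)
  qed
  then show ?thesis by (auto simp: wfp_def wf_iff_no_infinite_down_chain)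
qed

section \<open>Leading monomials and the ascending chain condition\<close>

lemma lookup_single_times:
  fixes g :: "('a::cancel_comm_monoid_add) \<Rightarrow>\<^sub>0 'b::semiring_0"
  shows "Poly_Mapping.lookup (Poly_Mapping.single a c * g) (a + m) = c * Poly_Mapping.lookup g m"
proof -
  have "(\<Sum>q. Poly_Mapping.lookup g q when a + m = k + q) =
      (if k = a then Poly_Mapping.lookup g m else (\<Sum>q. Poly_Mapping.lookup g q when a + m = k + q))"
    for k
    by simp
  then show ?thesis
    by (simp add: lookup_mult lookup_single when_mult)
qed

lemma keys_single_times_subset:
  "Poly_Mapping.keys (Poly_Mapping.single a c * g) \<subseteq> (+) a ` Poly_Mapping.keys g"
  using keys_mult[of "Poly_Mapping.single a c" g] by (auto split: if_splits)

definition leading_monomial :: "'k::linorder cox \<Rightarrow> ('k \<Rightarrow>\<^sub>0 nat)" where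
  "leading_monomial f = Max (Poly_Mapping.keys f)"

lemma leading_monomial_in_keys: "f \<noteq> 0 \<Longrightarrow> leading_monomial f \<in> Poly_Mapping.keys f"
  unfolding leading_monomial_def
  by (intro Max_in) (auto simp: poly_mapping_eq_iff in_keys_iff fun_eq_iff)

lemma le_leading_monomial: "m \<in> Poly_Mapping.keys f \<Longrightarrow> m \<le> leading_monomial f"
  unfolding leading_monomial_def by simp

lemma reduce_leading_monomial:
  fixes f g :: "'k::linorder cox"
  assumes "g \<noteq> 0" "f \<noteq> 0" and lm: "leading_monomial f = leading_monomial g + a"
  obtains r where "f - r * g = 0 \<or> leading_monomial (f - r * g) < leading_monomial f"
proof -
  \<comment> \<open>With this ratio of leading coefficients, \<open>r * g\<close> has the leading
    term of \<open>f\<close>, which cancels in the difference.\<close>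
  define c where "c = Poly_Mapping.lookup f (leading_monomial f) /
    Poly_Mapping.lookup g (leading_monomial g)"
  define r where "r = Poly_Mapping.single a c"
  have nz: "Poly_Mapping.lookup g (leading_monomial g) \<noteq> 0"
    using leading_monomial_in_keys[OF assms(1)] by (simp add: in_keys_iff)
  have top: "Poly_Mapping.lookup (f - r * g) (leading_monomial f) = 0"
    using nz lookup_single_times[of a c g "leading_monomial g"] lm
    by (simp add: r_def c_def lookup_minus add.commute)
  have le: "m \<le> leading_monomial f" if m: "m \<in> Poly_Mapping.keys (f - r * g)" for m
  proof -
    have "m \<in> Poly_Mapping.keys f \<or> m \<in> (+) a ` Poly_Mapping.keys g"
      using m keys_single_times_subset[of a c g] unfolding r_def
      by (auto simp: in_keys_iff lookup_minus)
    then show ?thesis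
    proof
      assume "m \<in> (+) a ` Poly_Mapping.keys g"
      then show ?thesis
        using le_leading_monomial[of _ g] unfolding lm add.commute[of _ a]
        by (auto intro: add_left_mono)
    qed (rule le_leading_monomial)
  qed
  have "leading_monomial (f - r * g) < leading_monomial f" if "f - r * g \<noteq> 0"
    using leading_monomial_in_keys[OF that] top le by (metis in_keys_iff order_less_le)
  then show thesis using that by blast
qed

text \<open>Choose in each \<open>A (Suc n) - A n\<close> an element of least leading monomial. By
  Dickson's lemma one of these leading monomials divides a later one, and a division step yields a
  smaller element of the later difference.\<close>

lemma no_strict_ascending_ideal_chain:
  fixes A :: "nat \<Rightarrow> 'k::{finite,linorder} cox set"
  assumes ideal: "\<And>n. is_ideal (A n)" and asc: "\<And>n. A n \<subset> A (Suc n)"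
  shows False
proof -
  have "\<exists>g. g \<in> A (Suc n) - A n \<and>
      (\<forall>f\<in>A (Suc n) - A n. \<not> leading_monomial f < leading_monomial g)" for n
  proof -
    have "leading_monomial ` (A (Suc n) - A n) \<noteq> {}" using asc[of n] by blast
    then obtain m where "m \<in> leading_monomial ` (A (Suc n) - A n)"
      "\<And>y. y < m \<Longrightarrow> y \<notin> leading_monomial ` (A (Suc n) - A n)"
      using wfp_monomial_less[unfolded wfp_def] wfE_min[of "{(x, y). x < y}"]
      by (metis (mono_tags, lifting) case_prodI ex_in_conv mem_Collect_eq)
    then show ?thesis by blast
  qed
  then obtain g where g: "\<And>n. g n \<in> A (Suc n)" "\<And>n. g n \<notin> A n"
    and least: "\<And>n f. f \<in> A (Suc n) - A n \<Longrightarrow> \<not> leading_monomial f < leading_monomial (g n)"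
    by (metis Diff_iff)
  have nz: "g n \<noteq> 0" for n
    using g(2)[of n] self_module.subspace_0[OF ideal[of n]] by auto
  obtain i j a where ij: "i < j" and lm: "leading_monomial (g j) = leading_monomial (g i) + a"
    using dickson[of "\<lambda>n. leading_monomial (g n)"] by blast
  obtain r where r: "g j - r * g i = 0 \<or> leading_monomial (g j - r * g i) < leading_monomial (g j)"
    using reduce_leading_monomial[OF nz nz lm] by blast
  have mono: "A m \<subseteq> A n" if "m \<le> n" for m n
    using lift_Suc_mono_le[of A m n] asc that by blast
  have "r * g i \<in> A j"
    using mono[of "Suc i" j] g(1)[of i] ij self_module.subspace_scale[OF ideal]
    by (simp add: subset_iff)
  moreover from this have "r * g i \<in> A (Suc j)" using mono[of j "Suc j"] by auto
  \<comment> \<open>Subtracting an element of \<open>A j\<close> cannot bring \<open>g j\<close>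
    into \<open>A j\<close>; in particular the remainder is not 0.\<close>
  ultimately have "g j - r * g i \<in> A (Suc j) - A j"
    using g[of j] self_module.subspace_diff[OF ideal[of "Suc j"], of "g j" "r * g i"]
      self_module.subspace_add[OF ideal[of j], of "g j - r * g i" "r * g i"]
    by auto
  with least[OF this] r show False
    using self_module.subspace_0[OF ideal[of j]] by auto
qed

text \<open>The larger ideal counts as the smaller element, so that well-founded minimality produces
  maximal ideals.\<close>

lemma wf_ideal_superset:
  "wf {(A, B). is_ideal A \<and> is_ideal B \<and> B \<subset> (A :: 'k::{finite,linorder} cox set)}"
  unfolding wf_iff_no_infinite_down_chain
proof
  assume "\<exists>A. \<forall>i. (A (Suc i), A i) \<in>
    {(A, B). is_ideal A \<and> is_ideal B \<and> B \<subset> (A :: 'k cox set)}"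
  then obtain A :: "nat \<Rightarrow> 'k cox set" where "is_ideal (A i)" "A i \<subset> A (Suc i)" for i
    by blast
  then show False using no_strict_ascending_ideal_chain[of A] by blast
qed

lemma maximal_ideal_in:
  fixes \<A> :: "'k::{finite,linorder} cox set set"
  assumes "A \<in> \<A>" and "\<And>A. A \<in> \<A> \<Longrightarrow> is_ideal A"
  obtains M where "M \<in> \<A>" "A \<subseteq> M" "\<And>B. B \<in> \<A> \<Longrightarrow> M \<subseteq> B \<Longrightarrow> B = M"
proof -
  have "A \<in> {B \<in> \<A>. A \<subseteq> B}" using assms(1) by simp
  then obtain M where M: "M \<in> {B \<in> \<A>. A \<subseteq> B}"
    "\<And>B. (B, M) \<in> {(A, B). is_ideal A \<and> is_ideal B \<and> B \<subset> A} \<Longrightarrow> B \<notin> {B \<in> \<A>. A \<subseteq> B}"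
    by (rule wfE_min[OF wf_ideal_superset]) auto
  show thesis using M assms(2) by (intro that[of M]) blast+
qed

text \<open>Among the ideals generated by finite subsets of \<open>G\<close> take a maximal one;
  adjoining another element of \<open>G\<close> cannot enlarge it.\<close>

lemma ideal_finitely_generated:
  fixes G :: "'k::{finite,linorder} cox set"
  obtains F where "finite F" "F \<subseteq> G" "G \<subseteq> ideal_generated F"
proof -
  have "ideal_generated {} \<in> {ideal_generated F | F. finite F \<and> F \<subseteq> G}" by blast
  then obtain M where M: "M \<in> {ideal_generated F | F. finite F \<and> F \<subseteq> G}"
    "\<And>B. B \<in> {ideal_generated F | F. finite F \<and> F \<subseteq> G} \<Longrightarrow> M \<subseteq> B \<Longrightarrow> B = M"
    using maximal_ideal_in[of "ideal_generated {}" "{ideal_generated F | F. finite F \<and> F \<subseteq> G}"]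
    by (smt (verit) mem_Collect_eq self_module.subspace_span)
  then obtain F where F: "M = ideal_generated F" "finite F" "F \<subseteq> G" by blast
  have "g \<in> ideal_generated F" if "g \<in> G" for g
  proof -
    have "ideal_generated (insert g F) = M"
      using F that by (intro M(2)) (auto intro!: self_module.span_mono exI[of _ "insert g F"])
    then show ?thesis using F(1) self_module.span_base[of g "insert g F"] by auto
  qed
  then show thesis using F that by blast
qed

section \<open>Zero divisors modulo an ideal\<close>

text \<open>The colon ideal \<open>(J : f)\<close>, that is, the annihilator of the class of
  \<open>f\<close> modulo \<open>J\<close>.\<close>

definition ideal_quotient :: "'a::comm_ring_1 set \<Rightarrow> 'a \<Rightarrow> 'a set" where
  "ideal_quotient J f = {a. a * f \<in> J}"

lemma is_ideal_ideal_quotient: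
  assumes "is_ideal J"
  shows "is_ideal (ideal_quotient J f)"
proof (rule self_module.subspaceI)
  show "0 \<in> ideal_quotient J f"
    using self_module.subspace_0[OF assms] by (simp add: ideal_quotient_def)
  show "a + b \<in> ideal_quotient J f" if "a \<in> ideal_quotient J f" "b \<in> ideal_quotient J f" for a b
    using that self_module.subspace_add[OF assms] by (simp add: ideal_quotient_def distrib_right)
  show "c * a \<in> ideal_quotient J f" if "a \<in> ideal_quotient J f" for c a
    using that self_module.subspace_scale[OF assms] by (simp add: ideal_quotient_def mult.assoc)
qed

text \<open>The maximal annihilators of nonzero classes modulo \<open>J\<close>. In a Noetherian
  ring their union is the set of zero divisors modulo \<open>J\<close>.\<close>

definition maximal_quotients :: "'a::comm_ring_1 set \<Rightarrow> 'a set set" where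
  "maximal_quotients J = {ideal_quotient J f | f. f \<notin> J \<and>
     (\<forall>g. g \<notin> J \<longrightarrow> ideal_quotient J f \<subseteq> ideal_quotient J g \<longrightarrow>
        ideal_quotient J g = ideal_quotient J f)}"

definition is_prime_ideal :: "'a::comm_ring_1 set \<Rightarrow> bool" where
  "is_prime_ideal P \<longleftrightarrow> is_ideal P \<and> 1 \<notin> P \<and> (\<forall>a b. a * b \<in> P \<longrightarrow> a \<in> P \<or> b \<in> P)"

text \<open>If \<open>P = (J : f)\<close> and \<open>b \<notin> P\<close>, then \<open>b * f\<close>
  is outside \<open>J\<close> and its colon ideal contains \<open>P\<close>, hence equals
  \<open>P\<close> by maximality. So \<open>a * b \<in> P\<close> gives
  \<open>a \<in> P\<close>.\<close>

lemma is_prime_ideal_maximal_quotient: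
  assumes J: "is_ideal J" and P: "P \<in> maximal_quotients J"
  shows "is_prime_ideal P"
proof -
  obtain f where f: "P = ideal_quotient J f" "f \<notin> J" and
    max: "\<And>g. g \<notin> J \<Longrightarrow> P \<subseteq> ideal_quotient J g \<Longrightarrow> ideal_quotient J g = P"
    using P unfolding maximal_quotients_def by blast
  have "a \<in> P" if ab: "a * b \<in> P" and b: "b \<notin> P" for a b
  proof -
    have "b * f \<notin> J" using b by (simp add: f(1) ideal_quotient_def)
    moreover have "P \<subseteq> ideal_quotient J (b * f)"
      unfolding f(1) ideal_quotient_def
      using self_module.subspace_scale[OF J, of _ b] by (auto simp: mult.left_commute[of _ b])
    ultimately have "ideal_quotient J (b * f) = P" by (rule max)
    then show ?thesis using ab by (auto simp: f(1) ideal_quotient_def mult.assoc)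
  qed
  moreover have "1 \<notin> P" using f by (simp add: ideal_quotient_def)
  ultimately show ?thesis
    using is_ideal_ideal_quotient[OF J] f(1) unfolding is_prime_ideal_def by blast
qed

lemma zero_divisor_in_maximal_quotient:
  fixes J :: "'k::{finite,linorder} cox set"
  assumes J: "is_ideal J" and "h * f \<in> J" "f \<notin> J"
  obtains P where "P \<in> maximal_quotients J" "h \<in> P"
proof -
  have "ideal_quotient J f \<in> {ideal_quotient J g | g. g \<notin> J}" using assms(3) by blast
  then obtain P where P: "P \<in> {ideal_quotient J g | g. g \<notin> J}" "ideal_quotient J f \<subseteq> P"
    "\<And>B. B \<in> {ideal_quotient J g | g. g \<notin> J} \<Longrightarrow> P \<subseteq> B \<Longrightarrow> B = P"
    using maximal_ideal_in[of _ "{ideal_quotient J g | g. g \<notin> J}"] is_ideal_ideal_quotient[OF J]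
    by (smt (verit, best) mem_Collect_eq)
  have "P \<in> maximal_quotients J" unfolding maximal_quotients_def using P(1,3) by blast
  moreover have "h \<in> P" using P(2) assms(2) by (auto simp: ideal_quotient_def)
  ultimately show thesis by (rule that)
qed

lemma is_prime_ideal_prod:
  assumes "is_prime_ideal P" "finite F" "\<And>x. x \<in> F \<Longrightarrow> a x \<notin> P"
  shows "prod a F \<notin> P"
  using assms(2,3)
  by (induction F) (use assms(1) in \<open>auto simp: is_prime_ideal_def\<close>)

lemma prod_in_ideal:
  assumes I: "is_ideal I" and "finite F" "x \<in> F" "a x \<in> I"
  shows "prod a F \<in> I"
proof -
  have "prod a F = prod a (F - {x}) * a x"
    using assms(2,3) by (simp add: prod.remove mult.commute)
  then show ?thesis using self_module.subspace_scale[OF I assms(4)] by simp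
qed

text \<open>
  If finitely many \<open>f\<^sub>P\<close> generate the ideal of all \<open>f\<^sub>P\<close>, then every maximal quotient contains the
  intersection of the corresponding \<open>(J : f\<^sub>P)\<close>, hence one of them by primality.
\<close>

lemma finite_maximal_quotients:
  fixes J :: "'k::{finite,linorder} cox set"
  assumes J: "is_ideal J"
  shows "finite (maximal_quotients J)"
proof -
  let ?G = "{f. ideal_quotient J f \<in> maximal_quotients J \<and> f \<notin> J}"
  obtain F where F: "finite F" "F \<subseteq> ?G" "?G \<subseteq> ideal_generated F"
    using ideal_finitely_generated by blast
  have "P \<in> ideal_quotient J ` F" if P: "P \<in> maximal_quotients J" for P
  proof -
    obtain f where f: "P = ideal_quotient J f" "f \<notin> J"
      using P unfolding maximal_quotients_def by blast
    have prime: "is_prime_ideal P" using is_prime_ideal_maximal_quotient[OF J P] .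
    have "\<exists>g\<in>F. ideal_quotient J g \<subseteq> P"
    proof (rule ccontr)
      assume "\<not> ?thesis"
      then have "\<forall>g\<in>F. \<exists>a. a \<in> ideal_quotient J g \<and> a \<notin> P" by blast
      then obtain a where a: "\<And>g. g \<in> F \<Longrightarrow> a g \<in> ideal_quotient J g" "\<And>g. g \<in> F \<Longrightarrow> a g \<notin> P"
        by metis
      have "F \<subseteq> {g. prod a F * g \<in> J}"
        using prod_in_ideal[OF is_ideal_ideal_quotient[OF J] F(1), of _ a] a(1)
        by (auto simp: ideal_quotient_def)
      moreover have "is_ideal {g. prod a F * g \<in> J}"
        using is_ideal_ideal_quotient[OF J, of "prod a F"]
        by (simp add: ideal_quotient_def mult.commute)
      ultimately have "ideal_generated F \<subseteq> {g. prod a F * g \<in> J}"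
        by (rule self_module.span_minimal)
      moreover have "f \<in> ideal_generated F" using F(3) P f by blast
      ultimately have "prod a F \<in> P" by (auto simp: f(1) ideal_quotient_def)
      moreover have "prod a F \<notin> P" by (rule is_prime_ideal_prod[OF prime F(1) a(2)])
      ultimately show False by contradiction
    qed
    \<comment> \<open>As \<open>F\<close> was chosen inside \<open>?G\<close>, the colon ideal of
      \<open>g\<close> is itself maximal and the inclusion is an equality.\<close>
    then obtain g where g: "g \<in> F" "ideal_quotient J g \<subseteq> P" by blast
    then have "ideal_quotient J g = P"
      using F(2) f unfolding maximal_quotients_def by blast
    then show ?thesis using g by blast
  qed
  then show ?thesis using F(1) by (meson finite_imageI finite_subset subsetI)
qed

section \<open>Powers of an ideal and saturation\<close>

lemma is_ideal_ideal_power: "is_ideal (ideal_power B n)"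
  by (cases n) (auto simp: self_module.subspace_span self_module.subspace_UNIV)

lemma ideal_power_Suc_subset: "ideal_power B (Suc n) \<subseteq> ideal_power B n"
proof -
  have "{a * b | a b. a \<in> B \<and> b \<in> ideal_power B n} \<subseteq> ideal_power B n"
    using self_module.subspace_scale[OF is_ideal_ideal_power] by blast
  then show ?thesis by (simp add: self_module.span_minimal is_ideal_ideal_power)
qed

lemma ideal_power_antimono: "m \<le> n \<Longrightarrow> ideal_power B n \<subseteq> ideal_power B m"
  using lift_Suc_antimono_le[of "ideal_power B" m n] ideal_power_Suc_subset by blast

lemma subset_ideal_saturation:
  assumes "is_ideal I"
  shows "I \<subseteq> ideal_saturation I B"
  unfolding ideal_saturation_def
  using self_module.subspace_scale[OF assms] by (auto simp: mult.commute)

lemma is_ideal_ideal_saturation: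
  assumes I: "is_ideal I"
  shows "is_ideal (ideal_saturation I B)"
proof (rule self_module.subspaceI)
  show "0 \<in> ideal_saturation I B"
    using self_module.subspace_0[OF I] by (simp add: ideal_saturation_def)
next
  fix f g assume "f \<in> ideal_saturation I B" "g \<in> ideal_saturation I B"
  then obtain m n where mn: "\<And>b. b \<in> ideal_power B m \<Longrightarrow> f * b \<in> I"
    "\<And>b. b \<in> ideal_power B n \<Longrightarrow> g * b \<in> I"
    unfolding ideal_saturation_def by blast
  have "(f + g) * b \<in> I" if "b \<in> ideal_power B (max m n)" for b
  proof -
    have "b \<in> ideal_power B m" "b \<in> ideal_power B n"
      using that ideal_power_antimono[of m "max m n" B] ideal_power_antimono[of n "max m n" B]
      by (meson max.cobounded1 max.cobounded2 subsetD)+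
    then show ?thesis
      unfolding distrib_right by (intro self_module.subspace_add[OF I] mn)
  qed
  then show "f + g \<in> ideal_saturation I B" unfolding ideal_saturation_def by blast
next
  fix c f assume "f \<in> ideal_saturation I B"
  then show "c * f \<in> ideal_saturation I B"
    unfolding ideal_saturation_def using self_module.subspace_scale[OF I, of _ c]
    by (auto simp: mult.assoc)
qed

text \<open>Finitely many generators admit a common exponent \<open>M\<close>, and the generator
  itself costs one further factor, so \<open>Suc M\<close> works for \<open>f\<close>.
  Contrapositively, for \<open>f\<close> outside the saturation some generator lies outside its
  colon ideal.\<close>

lemma ideal_saturation_idem:
  assumes I: "is_ideal I" and G: "finite G"
    and f: "\<And>g. g \<in> G \<Longrightarrow> g * f \<in> ideal_saturation I (ideal_generated G)"
  shows "f \<in> ideal_saturation I (ideal_generated G)"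
proof -
  let ?B = "ideal_generated G"
  obtain N where N: "\<And>g b. g \<in> G \<Longrightarrow> b \<in> ideal_power ?B (N g) \<Longrightarrow> g * f * b \<in> I"
    using f unfolding ideal_saturation_def mem_Collect_eq Ball_def by moura
  \<comment> \<open>The \<open>0\<close> keeps the maximum defined when \<open>G\<close> is
    empty.\<close>
  define M where "M = Max (insert 0 (N ` G))"
  have M: "g * f * b \<in> I" if "g \<in> G" "b \<in> ideal_power ?B M" for g b
  proof -
    have "N g \<le> M" using that(1) G by (simp add: M_def)
    then show ?thesis using N that ideal_power_antimono[of "N g" M ?B] by blast
  qed
  have "a * b * f \<in> I" if "a \<in> ?B" "b \<in> ideal_power ?B M" for a b
  proof -
    have "is_ideal {a. a * (b * f) \<in> I}"
      using is_ideal_ideal_quotient[OF I, of "b * f"] by (simp add: ideal_quotient_def)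
    moreover have "G \<subseteq> {a. a * (b * f) \<in> I}" using M that(2) by (auto simp: ac_simps)
    ultimately have "?B \<subseteq> {a. a * (b * f) \<in> I}" by (intro self_module.span_minimal)
    then show ?thesis using that(1) by (auto simp: mult.assoc)
  qed
  then have "{a * b | a b. a \<in> ?B \<and> b \<in> ideal_power ?B M} \<subseteq> ideal_quotient I f"
    by (auto simp: ideal_quotient_def)
  then have "ideal_power ?B (Suc M) \<subseteq> ideal_quotient I f"
    using self_module.span_minimal[OF _ is_ideal_ideal_quotient[OF I]] by simp
  then have "\<forall>b\<in>ideal_power ?B (Suc M). f * b \<in> I"
    by (auto simp: ideal_quotient_def mult.commute[of f])
  then show ?thesis unfolding ideal_saturation_def by blast
qed

section \<open>Avoiding finitely many subspaces\<close>

text \<open>Let \<open>v\<close> avoid the earlier subspaces and \<open>w\<close> the new one. The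
  line through \<open>v\<close> in direction \<open>w\<close> meets each subspace at most once, so
  over an infinite field some point of it avoids all of them.\<close>

lemma (in vector_space) exists_avoiding_subspaces:
  assumes inf: "infinite (UNIV :: 'a set)" and "finite \<W>" and V: "subspace V"
    and W: "\<And>W. W \<in> \<W> \<Longrightarrow> subspace W" "\<And>W. W \<in> \<W> \<Longrightarrow> \<not> V \<subseteq> W"
  shows "\<exists>v\<in>V. \<forall>W\<in>\<W>. v \<notin> W"
  using assms(2) W
proof (induction \<W>)
  case empty
  show ?case using subspace_0[OF V] by blast
next
  case (insert W \<W>)
  then obtain v where v: "v \<in> V" "\<And>W. W \<in> \<W> \<Longrightarrow> v \<notin> W" by auto
  obtain w where w: "w \<in> V" "w \<notin> W" using insert.prems(2)[of W] by auto
  have uniq: "finite {c. v + scale c w \<in> U}" if U: "U \<in> insert W \<W>" for U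
  proof -
    have sub: "subspace U" using insert.prems(1) U by blast
    \<comment> \<open>Two points of the line in \<open>U\<close> would put both \<open>w\<close> and
      \<open>v\<close> in \<open>U\<close>, but \<open>w\<close> is outside \<open>W\<close> and
      \<open>v\<close> outside every member of \<open>\<W>\<close>.\<close>
    have "c = d" if "v + scale c w \<in> U" "v + scale d w \<in> U" for c d
    proof (rule ccontr)
      assume "c \<noteq> d"
      have "scale (c - d) w \<in> U"
        using subspace_diff[OF sub that] by (simp add: scale_left_diff_distrib)
      then have "scale (inverse (c - d)) (scale (c - d) w) \<in> U" by (rule subspace_scale[OF sub])
      then have wU: "w \<in> U" using \<open>c \<noteq> d\<close> by simp
      have "v + scale c w - scale c w \<in> U"
        by (intro subspace_diff[OF sub] subspace_scale[OF sub] that wU)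
      then have "v \<in> U" by simp
      then show False using wU w(2) v(2) U by blast
    qed
    then have "{c. v + scale c w \<in> U} \<subseteq> {c. v + scale (SOME c. v + scale c w \<in> U) w \<in> U \<and>
      c = (SOME c. v + scale c w \<in> U)}"
      by (metis (mono_tags, lifting) mem_Collect_eq someI subsetI)
    then show ?thesis by (rule finite_subset) auto
  qed
  have "finite (\<Union>U\<in>insert W \<W>. {c. v + scale c w \<in> U})"
    using uniq insert.hyps(1) by blast
  then obtain c where "c \<notin> (\<Union>U\<in>insert W \<W>. {c. v + scale c w \<in> U})"
    using inf ex_new_if_finite by blast
  then show ?case
    using subspace_add[OF V v(1) subspace_scale[OF V w(1)], of c] by blast
qed

section \<open>Evaluation of polynomials\<close>

lemma poly_mapping_sum_single:
  fixes f :: "'a \<Rightarrow>\<^sub>0 'b::comm_monoid_add"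
  shows "(\<Sum>a\<in>Poly_Mapping.keys f. Poly_Mapping.single a (Poly_Mapping.lookup f a)) = f"
  by (rule poly_mapping_eqI)
    (simp add: lookup_sum lookup_single when_def in_keys_iff)

lemma cox_eval_superset:
  assumes "finite A" "Poly_Mapping.keys f \<subseteq> A"
  shows "cox_eval f x =
    (\<Sum>a\<in>A. Poly_Mapping.lookup f a * (\<Prod>i\<in>UNIV. (x $ i) ^ Poly_Mapping.lookup a i))"
  unfolding cox_eval_def
  by (rule sum.mono_neutral_left) (use assms in \<open>auto simp: in_keys_iff\<close>)

lemma cox_eval_0 [simp]: "cox_eval 0 x = 0"
  by (simp add: cox_eval_def)

lemma cox_eval_add: "cox_eval (f + g) x = cox_eval f x + cox_eval g x"
proof -
  let ?A = "Poly_Mapping.keys f \<union> Poly_Mapping.keys g"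
  have "Poly_Mapping.keys (f + g) \<subseteq> ?A" by (rule keys_add)
  then show ?thesis
    by (simp add: cox_eval_superset[of ?A] lookup_add distrib_right sum.distrib)
qed

lemma cox_eval_sum: "cox_eval (\<Sum>i\<in>A. f i) x = (\<Sum>i\<in>A. cox_eval (f i) x)"
  by (induction A rule: infinite_finite_induct) (simp_all add: cox_eval_add)

lemma cox_eval_single:
  "cox_eval (Poly_Mapping.single a c) x = c * (\<Prod>i\<in>UNIV. (x $ i) ^ Poly_Mapping.lookup a i)"
  by (simp add: cox_eval_def)

lemma cox_eval_mult: "cox_eval (f * g) x = cox_eval f x * cox_eval g x"
proof -
  let ?s = "\<lambda>f a. Poly_Mapping.single a (Poly_Mapping.lookup f a)"
  have "f * g = (\<Sum>a\<in>Poly_Mapping.keys f. \<Sum>b\<in>Poly_Mapping.keys g. ?s f a * ?s g b)"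
    by (simp add: poly_mapping_sum_single flip: sum_product)
  then have "cox_eval (f * g) x =
      (\<Sum>a\<in>Poly_Mapping.keys f. \<Sum>b\<in>Poly_Mapping.keys g. cox_eval (?s f a) x * cox_eval (?s g b) x)"
    by (simp add: cox_eval_sum mult_single cox_eval_single lookup_add power_add prod.distrib
        ac_simps)
  also have "\<dots> = cox_eval f x * cox_eval g x"
    by (subst (3 4) poly_mapping_sum_single[symmetric]) (simp only: cox_eval_sum sum_product)
  finally show ?thesis .
qed

lemma cox_eval_const [simp]: "cox_eval (Poly_Mapping.single 0 c) x = c"
  by (simp add: cox_eval_single)

lemma cox_eval_1 [simp]: "cox_eval 1 x = 1"
  by (metis cox_eval_const single_one)

lemma cox_eval_prod: "cox_eval (\<Prod>i\<in>A. f i) x = (\<Prod>i\<in>A. cox_eval (f i) x)"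
  by (induction A rule: infinite_finite_induct) (simp_all add: cox_eval_mult)

lemma cox_eval_power: "cox_eval (f ^ n) x = cox_eval f x ^ n"
  by (induction n) (simp_all add: cox_eval_mult)

lemma cox_eval_var [simp]: "cox_eval (cox_var i) x = x $ i"
proof -
  have "(\<Prod>j\<in>UNIV. (x $ j) ^ Poly_Mapping.lookup (Poly_Mapping.single i 1) j) =
      (\<Prod>j\<in>UNIV. if j = i then x $ i else 1)"
    by (intro prod.cong) (auto simp: lookup_single when_def)
  then show ?thesis by (simp add: cox_var_def cox_eval_single)
qed

lemma prod_cox_var_power:
  "(\<Prod>i\<in>UNIV. cox_var i ^ Poly_Mapping.lookup a i) =
    Poly_Mapping.single (a :: 'k::finite \<Rightarrow>\<^sub>0 nat) 1"
proof -
  have pow: "cox_var i ^ n = Poly_Mapping.single (Poly_Mapping.single i n) 1" for i :: 'k and n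
    by (induction n) (simp_all add: cox_var_def mult_single flip: single_add)
  have "(\<Prod>i\<in>A. cox_var i ^ Poly_Mapping.lookup a i) =
      Poly_Mapping.single (\<Sum>i\<in>A. Poly_Mapping.single i (Poly_Mapping.lookup a i)) 1"
    if "finite A" for A
    using that by (induction A) (simp_all add: pow mult_single)
  moreover have "(\<Sum>i\<in>UNIV. Poly_Mapping.single i (Poly_Mapping.lookup a i)) = a"
    by (rule poly_mapping_eqI) (simp add: lookup_sum lookup_single when_def)
  ultimately show ?thesis by simp
qed

lemma cox_induct [case_names const var add mult]:
  fixes f :: "'k::finite cox"
  assumes const: "\<And>c. Q (Poly_Mapping.single 0 c)" and var: "\<And>i. Q (cox_var i)"
    and add: "\<And>f g. Q f \<Longrightarrow> Q g \<Longrightarrow> Q (f + g)" and mult: "\<And>f g. Q f \<Longrightarrow> Q g \<Longrightarrow> Q (f * g)"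
  shows "Q f"
proof -
  have 0: "Q 0" using const[of 0] by simp
  have 1: "Q 1" using const[of 1] by simp
  have pow: "Q (cox_var i ^ n)" for i n
    by (induction n) (simp_all add: 1 var mult)
  have prod: "Q (\<Prod>i\<in>A. cox_var i ^ n i)" if "finite A" for A n
    using that by (induction A) (simp_all add: 1 pow mult)
  have single: "Q (Poly_Mapping.single a c)" for a c
    using mult[OF const[of c] prod[of UNIV "Poly_Mapping.lookup a"]]
    by (simp add: prod_cox_var_power mult_single)
  have "Q (\<Sum>a\<in>A. Poly_Mapping.single a (Poly_Mapping.lookup f a))" if "finite A" for A
    using that by (induction A) (simp_all add: 0 single add)
  from this[of "Poly_Mapping.keys f"] show ?thesis by (simp add: poly_mapping_sum_single)
qed

section \<open>The Nullstellensatz over the uncountable field of complex numbers\<close>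

text \<open>The algebra homomorphism from \<open>complex poly\<close> that sends the indeterminate
  to \<open>x\<close>; \<open>Poly_Mapping.single 0\<close> embeds the scalars.\<close>

definition poly_at :: "'k cox \<Rightarrow> complex poly \<Rightarrow> 'k cox" where
  "poly_at x p = poly (map_poly (Poly_Mapping.single 0) p) x"

lemma poly_at_0 [simp]: "poly_at x 0 = 0"
  by (simp add: poly_at_def)

lemma poly_at_pCons [simp]: "poly_at x (pCons c p) = Poly_Mapping.single 0 c + x * poly_at x p"
  by (simp add: poly_at_def map_poly_pCons)

lemma poly_at_add: "poly_at x (p + q) = poly_at x p + poly_at x q"
proof (induction p arbitrary: q)
  case (pCons c p)
  then show ?case by (cases q) (simp add: single_add algebra_simps)
qed simp

lemma poly_at_1 [simp]: "poly_at x 1 = 1"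
  by (simp add: one_pCons)

lemma poly_at_smult: "poly_at x (smult c p) = cox_scale c (poly_at x p)"
  by (induction p) (simp_all add: cox_scale_def mult_single algebra_simps)

lemma poly_at_mult: "poly_at x (p * q) = poly_at x p * poly_at x q"
  by (induction p) (simp_all add: poly_at_add poly_at_smult cox_scale_def algebra_simps)

lemma poly_at_sum: "poly_at x (\<Sum>i\<in>A. p i) = (\<Sum>i\<in>A. poly_at x (p i))"
  by (induction A rule: infinite_finite_induct) (simp_all add: poly_at_add)

lemma poly_at_prod: "poly_at x (\<Prod>i\<in>A. p i) = (\<Prod>i\<in>A. poly_at x (p i))"
  by (induction A rule: infinite_finite_induct) (simp_all add: poly_at_mult)

text \<open>The fundamental theorem of algebra splits off a linear factor, and primality puts it or
  its cofactor into \<open>Q\<close>. The descent in degree stops because a proper ideal contains no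
  nonzero constant.\<close>

lemma prime_ideal_root:
  assumes prime: "\<And>a b. a * b \<in> Q \<Longrightarrow> a \<in> Q \<or> b \<in> Q" and Q: "is_ideal Q" "1 \<notin> Q"
    and "p \<noteq> 0" "poly_at x p \<in> Q"
  shows "\<exists>c. x - Poly_Mapping.single 0 c \<in> Q"
  using assms(4,5)
proof (induction "degree p" arbitrary: p)
  case 0
  then obtain a where a: "p = [:a:]" by (metis degree_eq_zeroE)
  have "Poly_Mapping.single 0 (inverse a) * Poly_Mapping.single 0 a \<in> Q"
    using 0 a by (intro self_module.subspace_scale[OF Q(1)]) simp
  then show ?case using 0 a Q(2) by (simp add: mult_single)
next
  case (Suc n)
  then have "\<not> constant (poly p)" by (metis Zero_not_Suc constant_degree)
  then obtain z where "poly p z = 0" using fundamental_theorem_of_algebra by blast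
  then obtain q where q: "p = [:- z, 1:] * q" by (meson poly_eq_0_iff_dvd dvdE)
  then have "q \<noteq> 0" using Suc.prems(1) by auto
  then have deg: "n = degree q" using Suc.hyps(2) unfolding q by (subst (asm) degree_mult_eq) auto
  have "poly_at x p = (x - Poly_Mapping.single 0 z) * poly_at x q"
    unfolding q poly_at_mult by (simp add: single_uminus)
  then consider "x - Poly_Mapping.single 0 z \<in> Q" | "poly_at x q \<in> Q"
    using prime Suc.prems(2) by metis
  then show ?case using Suc.hyps(1)[OF deg \<open>q \<noteq> 0\<close>] by blast
qed

lemma countable_monomials: "countable (UNIV :: ('k::finite \<Rightarrow>\<^sub>0 nat) set)"
proof (rule countable_image_inj_on)
  show "inj (Poly_Mapping.lookup :: ('k \<Rightarrow>\<^sub>0 nat) \<Rightarrow> 'k \<Rightarrow> nat)"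
    by (auto intro: injI poly_mapping_eqI)
  show "countable (range (Poly_Mapping.lookup :: ('k \<Rightarrow>\<^sub>0 nat) \<Rightarrow> 'k \<Rightarrow> nat))"
    by (rule countableI_type)
qed

lemma infinite_fiber_of_uncountable:
  assumes "uncountable A" "f ` A \<subseteq> B" "countable B"
  obtains b where "infinite {a \<in> A. f a = b}"
proof -
  have "A \<subseteq> (\<Union>b\<in>B. {a \<in> A. f a = b})" using assms(2) by auto
  then have "\<not> (\<forall>b\<in>B. countable {a \<in> A. f a = b})"
    using assms(1,3) by (meson countable_UN countable_subset)
  then show thesis using that countable_finite by blast
qed

lemma cox_in_span_monomials:
  assumes "Poly_Mapping.keys f \<subseteq> A"
  shows "f \<in> cox.span ((\<lambda>a. Poly_Mapping.single a 1) ` A)"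
proof -
  have "(\<Sum>a\<in>Poly_Mapping.keys f. cox_scale (Poly_Mapping.lookup f a) (Poly_Mapping.single a 1))
      \<in> cox.span ((\<lambda>a. Poly_Mapping.single a 1) ` A)"
    using assms by (intro cox.span_sum cox.span_scale cox.span_base) auto
  then show ?thesis by (simp add: cox_scale_def mult_single poly_mapping_sum_single)
qed

text \<open>
  If no \<open>x - c\<close> lay in \<open>Q\<close>, then uncountably many \<open>1 / (x - c)\<close> would exist in the localization of
  \<open>S / Q\<close> at \<open>b\<close>, which has countable dimension; a linear relation between them would make
  \<open>x\<close> algebraic.
\<close>

lemma linear_in_ideal_maximal_avoiding_powers:
  fixes Q :: "'k::finite cox set"
  assumes Q: "is_ideal Q"
    and prime: "\<And>a b. a * b \<in> Q \<Longrightarrow> a \<in> Q \<or> b \<in> Q"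
    and avoid: "\<And>N. b ^ N \<notin> Q"
    and max: "\<And>a. a \<notin> Q \<Longrightarrow> \<exists>N r. b ^ N - r * a \<in> Q"
  shows "\<exists>c. x - Poly_Mapping.single 0 c \<in> Q"
proof (rule ccontr)
  let ?l = "\<lambda>c. x - Poly_Mapping.single 0 c"
  assume no: "\<nexists>c. ?l c \<in> Q"
  then have "\<forall>c. \<exists>N r. b ^ N - r * ?l c \<in> Q" using max by blast
  \<comment> \<open>Modulo \<open>Q\<close>, the fraction \<open>r c / b ^ N c\<close> plays the
    role of \<open>1 / (x - c)\<close>.\<close>
  then obtain N r where r: "\<And>c. b ^ N c - r c * ?l c \<in> Q" by metis
  have "uncountable (UNIV :: complex set)" by (rule uncountable_UNIV_complex)
  \<comment> \<open>There are only countably many pairs of an exponent and a finite support, so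
    infinitely many \<open>c\<close> share one. Their \<open>r c\<close> then lie in a
    finite-dimensional space.\<close>
  moreover have "range (\<lambda>c. (N c, Poly_Mapping.keys (r c))) \<subseteq> UNIV \<times> Collect finite" by auto
  moreover have "countable ((UNIV :: nat set) \<times> Collect (finite :: ('k \<Rightarrow>\<^sub>0 nat) set \<Rightarrow> bool))"
    using countable_Collect_finite_subset[OF countable_monomials]
    by (intro countable_SIGMA countableI_type) auto
  ultimately obtain NA where "infinite {c \<in> UNIV. (N c, Poly_Mapping.keys (r c)) = NA}"
    by (rule infinite_fiber_of_uncountable)
  then obtain M A where inf: "infinite {c. N c = M \<and> Poly_Mapping.keys (r c) = A}"
    by (cases NA) auto
  define C where "C = {c. N c = M \<and> Poly_Mapping.keys (r c) = A}"
  have rC: "b ^ M - r c * ?l c \<in> Q" if "c \<in> C" for c using r[of c] that by (simp add: C_def)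
  have "C \<noteq> {}" using inf unfolding C_def by (metis finite.emptyI)
  then have A: "finite A" by (auto simp: C_def)
  \<comment> \<open>If \<open>r c = r d\<close> for distinct \<open>c\<close> and \<open>d\<close>,
    subtracting the two congruences puts a nonzero scalar multiple of \<open>r c\<close> into
    \<open>Q\<close>, hence \<open>r c\<close> and then \<open>b ^ M\<close>.\<close>
  have "inj_on r C"
  proof (rule inj_onI, rule ccontr)
    fix c d assume cd: "c \<in> C" "d \<in> C" "r c = r d" "c \<noteq> d"
    have "b ^ M - r c * ?l c - (b ^ M - r d * ?l d) \<in> Q"
      by (rule self_module.subspace_diff[OF Q rC[OF cd(1)] rC[OF cd(2)]])
    moreover have "b ^ M - r c * ?l c - (b ^ M - r d * ?l d) = r c * Poly_Mapping.single 0 (c - d)"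
      by (simp add: cd(3) single_diff algebra_simps)
    ultimately have "Poly_Mapping.single 0 (inverse (c - d)) *
        (r c * Poly_Mapping.single 0 (c - d)) \<in> Q"
      by (metis self_module.subspace_scale[OF Q])
    then have "r c \<in> Q" using cd(4) by (simp add: mult.left_commute[of _ "r c"] mult_single)
    then have "b ^ M - r c * ?l c + ?l c * r c \<in> Q"
      by (intro self_module.subspace_add[OF Q rC[OF cd(1)]] self_module.subspace_scale[OF Q])
    then show False using avoid[of M] by (simp add: mult.commute)
  qed
  then have "infinite (r ` C)" using inf finite_imageD unfolding C_def by blast
  moreover have "r ` C \<subseteq> cox.span ((\<lambda>a. Poly_Mapping.single a 1) ` A)"
    using cox_in_span_monomials by (auto simp: C_def)
  ultimately have "cox.dependent (r ` C)"
    using cox.independent_span_bound A by blast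
  then obtain S u where S: "finite S" "S \<subseteq> r ` C" "\<exists>v\<in>S. u v \<noteq> 0"
    "(\<Sum>v\<in>S. cox_scale (u v) v) = 0"
    unfolding cox.dependent_explicit by blast
  obtain D where D: "D \<subseteq> C" "finite D" "S = r ` D"
    using S(1,2) by (meson finite_subset_image)
  have injD: "inj_on r D" using \<open>inj_on r C\<close> D(1) by (rule inj_on_subset)
  define lam where "lam c = u (r c)" for c
  have rel: "(\<Sum>c\<in>D. cox_scale (lam c) (r c)) = 0"
    using S(4) unfolding D(3) lam_def by (simp add: sum.reindex[OF injD])
  obtain d where d: "d \<in> D" "lam d \<noteq> 0" using S(3) unfolding D(3) lam_def by blast
  \<comment> \<open>These products clear the denominators of \<open>rel\<close>. At \<open>d\<close>
    only the term of \<open>q d\<close> survives, which shows that \<open>p\<close> is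
    nonzero.\<close>
  define q where "q c = (\<Prod>e\<in>D - {c}. [:- e, 1:])" for c :: complex
  define p where "p = (\<Sum>c\<in>D. smult (lam c) (q c))"
  have atq: "poly_at x (q c) = (\<Prod>e\<in>D - {c}. ?l e)" for c
    by (simp add: q_def poly_at_prod single_uminus)
  have q_mult: "?l c * poly_at x (q c) = (\<Prod>e\<in>D. ?l e)" if "c \<in> D" for c
    unfolding atq using D(2) that by (simp add: prod.remove)
  have "poly p d = (\<Sum>c\<in>D. if c = d then lam d * poly (q d) d else 0)"
    unfolding p_def poly_sum
    by (rule sum.cong) (use D(2) d(1) in \<open>auto simp: q_def poly_prod\<close>)
  also have "\<dots> \<noteq> 0" using d D(2) by (auto simp: q_def poly_prod)
  finally have "p \<noteq> 0" by auto
  \<comment> \<open>In the weighted sum of the congruences, the terms with \<open>r c\<close> add up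
    to the full product times the relation \<open>rel\<close>, which is zero. What remains is
    \<open>b ^ M * poly_at x p\<close>.\<close>
  have "(\<Sum>c\<in>D. cox_scale (lam c) (poly_at x (q c)) * (b ^ M - r c * ?l c)) \<in> Q"
    using D(1) rC by (intro self_module.subspace_sum[OF Q] self_module.subspace_scale[OF Q]) auto
  also have "(\<Sum>c\<in>D. cox_scale (lam c) (poly_at x (q c)) * (b ^ M - r c * ?l c)) =
      (\<Sum>c\<in>D. b ^ M * cox_scale (lam c) (poly_at x (q c)) -
        (\<Prod>e\<in>D. ?l e) * cox_scale (lam c) (r c))"
  proof (rule sum.cong[OF refl])
    fix c assume "c \<in> D"
    show "cox_scale (lam c) (poly_at x (q c)) * (b ^ M - r c * ?l c) =
      b ^ M * cox_scale (lam c) (poly_at x (q c)) - (\<Prod>e\<in>D. ?l e) * cox_scale (lam c) (r c)"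
      unfolding q_mult[OF \<open>c \<in> D\<close>, symmetric] cox_scale_def by (simp add: algebra_simps)
  qed
  also have "\<dots> = b ^ M * poly_at x p"
    unfolding sum_subtractf sum_distrib_left[symmetric] rel p_def
    by (simp add: poly_at_sum poly_at_smult)
  finally have "poly_at x p \<in> Q" using prime avoid by blast
  moreover have "1 \<notin> Q" using avoid[of 0] by simp
  ultimately show False using prime_ideal_root[OF prime Q _ \<open>p \<noteq> 0\<close>] no by blast
qed

text \<open>An ideal above \<open>I\<close> that is maximal among those without powers of
  \<open>b\<close> is prime, and modulo it every variable is congruent to a complex number. These
  numbers are the coordinates of the point.\<close>

lemma nullstellensatz:
  fixes I :: "'k::{finite,linorder} cox set"
  assumes I: "is_ideal I" and b: "\<And>N. b ^ N \<notin> I"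
  obtains x where "\<And>f. f \<in> I \<Longrightarrow> cox_eval f x = 0" "cox_eval b x \<noteq> 0"
proof -
  let ?A = "{A. is_ideal A \<and> (\<forall>N. b ^ N \<notin> A)}"
  have "I \<in> ?A" using I b by simp
  moreover have "\<And>A. A \<in> ?A \<Longrightarrow> is_ideal A" by simp
  ultimately obtain Q where QA: "Q \<in> ?A" and IQ: "I \<subseteq> Q"
    and Qmax: "\<And>B. B \<in> ?A \<Longrightarrow> Q \<subseteq> B \<Longrightarrow> B = Q"
    using maximal_ideal_in[of I ?A thesis] by presburger
  from QA have Q: "is_ideal Q" "\<And>N. b ^ N \<notin> Q" by simp_all
  have max: "\<exists>N r. b ^ N - r * a \<in> Q" if "a \<notin> Q" for a
  proof -
    have "ideal_generated (insert a Q) \<noteq> Q" "Q \<subseteq> ideal_generated (insert a Q)"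
      using that self_module.span_superset[of "insert a Q"] by blast+
    then have "ideal_generated (insert a Q) \<notin> ?A" using Qmax by blast
    then obtain N where "b ^ N \<in> ideal_generated (insert a Q)"
      using self_module.subspace_span by blast
    moreover have "ideal_generated Q = Q" using Q(1) by simp
    ultimately show ?thesis unfolding self_module.span_breakdown_eq by metis
  qed
  have prime: "a \<in> Q \<or> c \<in> Q" if ac: "a * c \<in> Q" for a c
  proof (rule ccontr)
    assume "\<not> ?thesis"
    then obtain N r M s where rs: "b ^ N - r * a \<in> Q" "b ^ M - s * c \<in> Q" using max by meson
    \<comment> \<open>Multiplying the congruences \<open>b ^ N = r * a\<close> and
      \<open>b ^ M = s * c\<close> shows that a power of \<open>b\<close> would lie in
      \<open>Q\<close>.\<close>
    have "b ^ M * (b ^ N - r * a) + ((r * a) * (b ^ M - s * c) + (r * s) * (a * c)) \<in> Q"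
      using self_module.subspace_scale[OF Q(1)] rs ac
      by (intro self_module.subspace_add[OF Q(1)]) blast+
    moreover have "b ^ M * (b ^ N - r * a) + ((r * a) * (b ^ M - s * c) + (r * s) * (a * c)) =
      b ^ (M + N)"
      by (simp add: power_add algebra_simps)
    ultimately show False using Q(2) by metis
  qed
  have "\<exists>c. cox_var i - Poly_Mapping.single 0 c \<in> Q" for i
    using Q(1) prime Q(2) max by (rule linear_in_ideal_maximal_avoiding_powers)
  then obtain c where c: "\<And>i. cox_var i - Poly_Mapping.single 0 (c i) \<in> Q" by metis
  define x where "x = (\<chi> i. c i)"
  \<comment> \<open>Every polynomial is congruent to its value at \<open>x\<close>, since the
    variables are. For an element of \<open>I\<close> this constant lies in \<open>Q\<close>, so it
    is 0; the value of \<open>b\<close> is not 0, as \<open>b\<close> is outside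
    \<open>Q\<close>.\<close>
  have cong: "f - Poly_Mapping.single 0 (cox_eval f x) \<in> Q" for f
  proof (induction f rule: cox_induct)
    case (const c)
    then show ?case using self_module.subspace_0[OF Q(1)] by simp
  next
    case (var i)
    then show ?case using c[of i] by (simp add: x_def)
  next
    case (add f g)
    have "f + g - Poly_Mapping.single 0 (cox_eval (f + g) x) =
      (f - Poly_Mapping.single 0 (cox_eval f x)) + (g - Poly_Mapping.single 0 (cox_eval g x))"
      by (simp add: cox_eval_add single_add)
    then show ?case using self_module.subspace_add[OF Q(1) add] by metis
  next
    case (mult f g)
    have "f * g - Poly_Mapping.single 0 (cox_eval (f * g) x) =
      g * (f - Poly_Mapping.single 0 (cox_eval f x)) +
      Poly_Mapping.single 0 (cox_eval f x) * (g - Poly_Mapping.single 0 (cox_eval g x))"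
      by (simp add: cox_eval_mult mult_single algebra_simps)
    then show ?case
      using mult by (metis self_module.subspace_add[OF Q(1)] self_module.subspace_scale[OF Q(1)])
  qed
  show thesis
  proof (rule that)
    fix f assume "f \<in> I"
    then have "f - (f - Poly_Mapping.single 0 (cox_eval f x)) \<in> Q"
      using self_module.subspace_diff[OF Q(1) _ cong[of f], of f] IQ by blast
    then have "Poly_Mapping.single 0 (inverse (cox_eval f x)) *
        Poly_Mapping.single 0 (cox_eval f x) \<in> Q"
      by (intro self_module.subspace_scale[OF Q(1)]) simp
    then show "cox_eval f x = 0"
      using Q(2)[of 0] by (cases "cox_eval f x = 0") (simp_all add: mult_single)
  next
    show "cox_eval b x \<noteq> 0" using cong[of b] Q(2)[of 1] by auto
  qed
qed

section \<open>Grading by the class group\<close>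

lemma char_divisor_add: "char_divisor u (m + m') = char_divisor u m + char_divisor u m'"
  by (simp add: char_divisor_def pairing_def lookup_add distrib_right sum.distrib single_add)

lemma char_divisor_0: "char_divisor u 0 = 0"
  using char_divisor_add[of u 0 0] by simp

lemma normal_char_divisors: "char_divisor u ` UNIV \<lhd> free_Abelian_group UNIV"
proof -
  interpret comm_group "free_Abelian_group (UNIV :: 'a set)"
    by (rule abelian_free_Abelian_group)
  have "- char_divisor u m = char_divisor u (- m)" for m
    using char_divisor_add[of u m "- m"] by (simp add: char_divisor_0 minus_unique)
  then have "subgroup (char_divisor u ` UNIV) (free_Abelian_group UNIV)"
    by (intro subgroupI) (auto simp flip: char_divisor_add)
  then show ?thesis by (simp add: normal_iff_subgroup)
qed

lemma group_class_group: "group (class_group u)"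
  unfolding class_group_def by (rule normal.factorgroup_is_group[OF normal_char_divisors])

lemma divisor_class_in_carrier: "divisor_class u D \<in> carrier (class_group u)"
  by (auto simp: class_group_def divisor_class_def carrier_FactGroup)

lemma divisor_class_add:
  "divisor_class u (D + D') = divisor_class u D \<otimes>\<^bsub>class_group u\<^esub> divisor_class u D'"
  using normal.rcos_sum[OF normal_char_divisors, of D D' u]
  by (simp add: divisor_class_def class_group_def)

lemma monomial_degree_add:
  "monomial_degree u (a + b) = monomial_degree u a \<otimes>\<^bsub>class_group u\<^esub> monomial_degree u b"
  unfolding monomial_degree_def divisor_class_add[symmetric]
  by (simp add: lookup_add single_add sum.distrib)

lemma graded_piece_mult:
  assumes "f \<in> graded_piece u \<alpha>" "g \<in> graded_piece u \<beta>"
  shows "f * g \<in> graded_piece u (\<alpha> \<otimes>\<^bsub>class_group u\<^esub> \<beta>)"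
  using assms keys_mult[of f g] by (force simp: graded_piece_def monomial_degree_add)

lemma subspace_graded_piece: "cox.subspace (graded_piece u \<alpha>)"
proof (rule cox.subspaceI)
  fix f g assume "f \<in> graded_piece u \<alpha>" "g \<in> graded_piece u \<alpha>"
  then show "f + g \<in> graded_piece u \<alpha>"
    using keys_add[of f g] by (auto simp: graded_piece_def)
next
  fix c f assume "f \<in> graded_piece u \<alpha>"
  then show "cox_scale c f \<in> graded_piece u \<alpha>"
    using keys_single_times_subset[of 0 c f] by (auto simp: graded_piece_def cox_scale_def)
qed (simp add: graded_piece_def)

lemma subspace_ideal:
  assumes "is_ideal I"
  shows "cox.subspace I"
  using assms
  by (intro cox.subspaceI)
    (auto simp: cox_scale_def self_module.subspace_0
      self_module.subspace_add self_module.subspace_scale)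

section \<open>Points of the variety from points of the affine cone\<close>

text \<open>Multiplication by the power clears the negative exponents, all of which belong to
  nonzero \<open>y i\<close>; inside \<open>R\<close> a \<open>y i\<close> may be 0. The identity
  serves both for variables in the fraction field and for coordinates of a point.\<close>

lemma prod_power_int_mult_power:
  fixes y :: "'k::finite \<Rightarrow> 'a::field"
  assumes "\<And>i. i \<in> R \<Longrightarrow> 0 \<le> k i" "\<And>i. i \<notin> R \<Longrightarrow> y i \<noteq> 0"
    "\<And>i. i \<notin> R \<Longrightarrow> 0 \<le> k i + int M"
  shows "(\<Prod>i\<in>UNIV. y i powi k i) * (\<Prod>i\<in>-R. y i) ^ M =
    (\<Prod>i\<in>UNIV. y i ^ nat (if i \<in> R then k i else k i + int M))"
proof -
  have "(\<Prod>i\<in>-R. y i) ^ M = (\<Prod>i\<in>UNIV. if i \<in> R then 1 else y i ^ M)"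
    by (simp add: prod_power_distrib prod.If_cases Compl_eq)
  then have "(\<Prod>i\<in>UNIV. y i powi k i) * (\<Prod>i\<in>-R. y i) ^ M =
    (\<Prod>i\<in>UNIV. y i powi k i * (if i \<in> R then 1 else y i ^ M))"
    by (simp add: prod.distrib)
  also have "\<dots> = (\<Prod>i\<in>UNIV. y i ^ nat (if i \<in> R then k i else k i + int M))"
  proof (rule prod.cong[OF refl])
    fix i
    show "y i powi k i * (if i \<in> R then 1 else y i ^ M) =
      y i ^ nat (if i \<in> R then k i else k i + int M)"
    proof (cases "i \<in> R")
      case True
      then show ?thesis using assms(1)[of i] by (simp add: power_int_def)
    next
      case False
      then have "y i powi (k i + int M) = y i ^ nat (k i + int M)"
        using assms(3)[of i] by (simp add: power_int_def)
      then show ?thesis using False assms(2)[of i] by (simp add: power_int_add)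
    qed
  qed
  finally show ?thesis .
qed

lemma inner_real_point: "real_point m \<bullet> real_point v = of_int (pairing m v)"
  by (simp add: real_point_def inner_vec_def pairing_def)

lemma pairing_nonneg:
  assumes "m \<in> dual_monoid \<sigma>" "i \<in> cone_rays u \<sigma>"
  shows "0 \<le> pairing m (u i)"
  using assms inner_real_point[of m "u i"] by (auto simp: dual_monoid_def cone_rays_def)

lemma cox_eval_cone_monomial: "cox_eval (cone_monomial u \<sigma>) x = (\<Prod>i\<in>- cone_rays u \<sigma>. x $ i)"
  by (simp add: cone_monomial_def cox_eval_prod)

lemma dual_monoid_add: "m \<in> dual_monoid \<sigma> \<Longrightarrow> m' \<in> dual_monoid \<sigma> \<Longrightarrow> m + m' \<in> dual_monoid \<sigma>"
proof -
  have "real_point (m + m') = real_point m + real_point m'"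
    by (simp add: real_point_def lookup_add vec_eq_iff)
  then show "m \<in> dual_monoid \<sigma> \<Longrightarrow> m' \<in> dual_monoid \<sigma> \<Longrightarrow> m + m' \<in> dual_monoid \<sigma>"
    by (simp add: dual_monoid_def inner_add_left)
qed

text \<open>Powers multiply correctly for two different reasons: off the rays of the cone the
  coordinates are nonzero, and on them the exponents are nonnegative.\<close>

lemma cox_map_chart_in_chart_points:
  assumes "cox_eval (cone_monomial u \<sigma>) x \<noteq> 0"
  shows "cox_map_chart u \<sigma> x \<in> chart_points \<sigma>"
proof -
  have nz: "x $ i \<noteq> 0" if "i \<notin> cone_rays u \<sigma>" for i
    using assms that by (simp add: cox_eval_cone_monomial)
  have add: "(x $ i) powi pairing (m + m') (u i) =
      (x $ i) powi pairing m (u i) * (x $ i) powi pairing m' (u i)"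
    if "m \<in> dual_monoid \<sigma>" "m' \<in> dual_monoid \<sigma>" for m m' i
  proof -
    have eq: "pairing (m + m') (u i) = pairing m (u i) + pairing m' (u i)"
      by (simp add: pairing_def lookup_add distrib_right sum.distrib)
    show ?thesis
    proof (cases "i \<in> cone_rays u \<sigma>")
      case True
      then show ?thesis
        using pairing_nonneg[OF that(1) True] pairing_nonneg[OF that(2) True]
        by (simp add: eq power_int_def nat_add_distrib power_add)
    next
      case False
      then show ?thesis using nz by (simp add: eq power_int_add)
    qed
  qed
  have "0 \<in> dual_monoid \<sigma>" by (simp add: dual_monoid_def real_point_def inner_vec_def)
  moreover have "pairing 0 v = 0" for v :: "'b lattice" by (simp add: pairing_def)
  ultimately show ?thesis
    by (auto simp: chart_points_def cox_map_chart_def dual_monoid_add add prod.distrib)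
qed

text \<open>Clearing denominators turns membership in the localized ideal into an identity
  \<open>f * ?s ^ M = p * ?s ^ N\<close> of polynomials. At \<open>x\<close> the factor
  \<open>f\<close> vanishes and the cone monomial \<open>?s\<close> does not.\<close>

lemma chart_ideal_vanishes:
  fixes u :: "'k::{finite,linorder} \<Rightarrow> 'n::finite lattice"
  assumes x: "cox_eval (cone_monomial u \<sigma>) x \<noteq> 0" and I: "\<And>f. f \<in> I \<Longrightarrow> cox_eval f x = 0"
    and g: "g \<in> chart_ideal u \<sigma> I"
  shows "chart_eval g (cox_map_chart u \<sigma> x) = 0"
proof -
  let ?s = "cone_monomial u \<sigma>" and ?R = "cone_rays u \<sigma>"
  have gm: "m \<in> dual_monoid \<sigma>" if "m \<in> Poly_Mapping.keys g" for m
    using g that by (auto simp: chart_ideal_def coord_ring_def)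
  obtain f N where f: "f \<in> I" "homogenize u g = Fract f (?s ^ N)"
    using g by (auto simp: chart_ideal_def localized_ideal_def)
  \<comment> \<open>\<open>M\<close> bounds the absolute values of all pairings that occur, so
    \<open>nat\<close> truncates none of the exponents \<open>?e m i\<close> for \<open>m\<close> in
    the support of \<open>g\<close>.\<close>
  define M where "M = nat (Max ((\<lambda>(m, i). \<bar>pairing m (u i)\<bar>) ` (Poly_Mapping.keys g \<times> UNIV)))"
  have M: "0 \<le> pairing m (u i) + int M" if "m \<in> Poly_Mapping.keys g" for m i
  proof -
    have "\<bar>pairing m (u i)\<bar> \<le> Max ((\<lambda>(m, i). \<bar>pairing m (u i)\<bar>) ` (Poly_Mapping.keys g \<times> UNIV))"
      by (rule Max_ge) (use that in auto)
    then show ?thesis unfolding M_def by linarith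
  qed
  let ?e = "\<lambda>m i. nat (if i \<in> ?R then pairing m (u i) else pairing m (u i) + int M)"
  define p where "p = (\<Sum>m\<in>Poly_Mapping.keys g. Poly_Mapping.single 0 (Poly_Mapping.lookup g m) *
    (\<Prod>i\<in>UNIV. cox_var i ^ ?e m i))"
  have var_nz: "cox_var i \<noteq> (0 :: 'k cox)" for i
  proof
    assume "cox_var i = (0 :: 'k cox)"
    then have "cox_eval (cox_var i) (\<chi> _. 1) = 0" by simp
    then show False by simp
  qed
  have s_nz: "?s \<noteq> 0" using x by auto
  have Fract_mult: "Fract (a * b) 1 = Fract a 1 * Fract b 1" for a b :: "'k cox" by simp
  have Fract_add: "Fract (a + b) 1 = Fract a 1 + Fract b 1" for a b :: "'k cox" by simp
  have Fract_sum: "Fract (sum a A) 1 = (\<Sum>i\<in>A. Fract (a i) 1)" for a :: "'c \<Rightarrow> 'k cox" and A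
    by (induction A rule: infinite_finite_induct)
      (simp_all add: Fract_add fract_collapse del: add_fract)
  have Fract_power: "Fract (a ^ n) 1 = Fract a 1 ^ n" for a :: "'k cox" and n
    by (induction n) (simp_all add: fract_collapse Fract_mult del: mult_fract)
  have Fract_prod: "Fract (prod a A) 1 = (\<Prod>i\<in>A. Fract (a i) 1)" for a :: "'c \<Rightarrow> 'k cox" and A
    by (induction A rule: infinite_finite_induct)
      (simp_all add: fract_collapse Fract_mult del: mult_fract)
  have Fract_var_nz: "Fract (cox_var i) 1 \<noteq> (0 :: 'k cox fract)" for i
    using var_nz[of i] unfolding Zero_fract_def by (subst eq_fract) auto
  have "homogenize u g * Fract (?s ^ M) 1 = Fract p 1"
  proof -
    have "(\<Prod>i\<in>UNIV. (Fract (cox_var i) 1) powi (pairing m (u i))) * Fract (?s ^ M) 1 =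
        Fract (\<Prod>i\<in>UNIV. cox_var i ^ ?e m i) 1" if m: "m \<in> Poly_Mapping.keys g" for m
      unfolding Fract_power Fract_prod cone_monomial_def
      by (rule prod_power_int_mult_power)
        (use M[OF m] pairing_nonneg[OF gm[OF m]] Fract_var_nz in auto)
    then show ?thesis
      unfolding homogenize_def p_def Fract_sum Fract_mult sum_distrib_right
      by (intro sum.cong refl) (simp only: mult.assoc)
  qed
  then have "Fract (f * ?s ^ M) (?s ^ N) = Fract p 1" by (simp add: f(2))
  then have "f * ?s ^ M = p * ?s ^ N" using s_nz by (simp add: eq_fract)
  then have "cox_eval p x * cox_eval ?s x ^ N = 0"
    using I[OF f(1)] by (metis cox_eval_mult cox_eval_power mult_zero_left)
  then have "cox_eval p x = 0" using x by simp
  \<comment> \<open>Up to the nonzero factor \<open>cox_eval ?s x ^ M\<close>, the value of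
    \<open>p\<close> is the value of \<open>g\<close> on the chart.\<close>
  moreover have "cox_eval p x = (\<Sum>m\<in>Poly_Mapping.keys g. Poly_Mapping.lookup g m *
      ((\<Prod>i\<in>UNIV. (x $ i) powi pairing m (u i)) * cox_eval ?s x ^ M))"
    unfolding p_def cox_eval_sum cox_eval_mult cox_eval_const cox_eval_prod cox_eval_power
      cox_eval_var cox_eval_cone_monomial
  proof (intro sum.cong refl arg_cong2[where f = "(*)"])
    fix m assume m: "m \<in> Poly_Mapping.keys g"
    show "(\<Prod>i\<in>UNIV. x $ i ^ ?e m i) =
      (\<Prod>i\<in>UNIV. x $ i powi pairing m (u i)) * (\<Prod>i\<in>- ?R. x $ i) ^ M"
      by (rule prod_power_int_mult_power[symmetric])
        (use M[OF m] pairing_nonneg[OF gm[OF m]] x in \<open>auto simp: cox_eval_cone_monomial\<close>)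
  qed
  moreover have "\<dots> = chart_eval g (cox_map_chart u \<sigma> x) * cox_eval ?s x ^ M"
    unfolding chart_eval_def sum_distrib_right
    by (intro sum.cong refl) (simp add: cox_map_chart_def gm)
  ultimately show ?thesis using x by simp
qed

section \<open>Points over the subscheme and sections that do not vanish there\<close>

lemma cone_monomial_nonzero_off_irrelevant_locus:
  assumes "x \<notin> irrelevant_locus \<Sigma> u"
  shows "\<exists>\<sigma>\<in>\<Sigma>. cox_eval (cone_monomial u \<sigma>) x \<noteq> 0"
proof (rule ccontr)
  assume "\<not> ?thesis"
  then have "cone_monomial u ` \<Sigma> \<subseteq> {b. cox_eval b x = 0}" by auto
  moreover have "is_ideal {b. cox_eval b x = 0}"
    by (rule self_module.subspaceI) (auto simp: cox_eval_add cox_eval_mult)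
  ultimately have "irrelevant_ideal \<Sigma> u \<subseteq> {b. cox_eval b x = 0}"
    unfolding irrelevant_ideal_def by (rule self_module.span_minimal)
  then show False using assms by (auto simp: irrelevant_locus_def)
qed

text \<open>The chart that \<open>cox_map\<close> itself selects provides the representative on
  which \<open>chart_ideal\<close> vanishes.\<close>

lemma cox_map_in_var_of_ideal:
  assumes x: "x \<notin> irrelevant_locus \<Sigma> u" and I: "\<And>f. f \<in> I \<Longrightarrow> cox_eval f x = 0"
  shows "cox_map \<Sigma> u x \<in> var_of_ideal \<Sigma> u I"
proof -
  define \<sigma> where "\<sigma> = (SOME \<sigma>. \<sigma> \<in> \<Sigma> \<and> cox_eval (cone_monomial u \<sigma>) x \<noteq> 0)"
  have "\<exists>\<sigma>. \<sigma> \<in> \<Sigma> \<and> cox_eval (cone_monomial u \<sigma>) x \<noteq> 0"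
    using cone_monomial_nonzero_off_irrelevant_locus[OF x] by blast
  then have \<sigma>: "\<sigma> \<in> \<Sigma>" "cox_eval (cone_monomial u \<sigma>) x \<noteq> 0"
    unfolding \<sigma>_def by (metis (mono_tags, lifting) someI_ex)+
  have eq: "cox_map \<Sigma> u x = gluing \<Sigma> `` {(\<sigma>, cox_map_chart u \<sigma> x)}"
    by (simp add: cox_map_def \<sigma>_def chart_incl_def Let_def)
  have "(\<sigma>, cox_map_chart u \<sigma> x) \<in> cox_map \<Sigma> u x"
    by (simp add: eq gluing_def)
  moreover have "cox_map \<Sigma> u x \<in> toric_variety \<Sigma>"
    unfolding eq toric_variety_def
    by (rule quotientI) (simp add: \<sigma> cox_map_chart_in_chart_points)
  moreover have "\<forall>g\<in>chart_ideal u \<sigma> I. chart_eval g (cox_map_chart u \<sigma> x) = 0"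
    using chart_ideal_vanishes[OF \<sigma>(2) I] by blast
  ultimately show ?thesis unfolding var_of_ideal_def by blast
qed

text \<open>Because \<open>var_of_section\<close> asks for a zero somewhere in the fiber, a section
  avoiding the point is nonzero on the whole fiber, in particular at \<open>x\<close>.\<close>

lemma basepoint_free_section:
  assumes "basepoint_free \<Sigma> u I \<alpha>" "x \<notin> irrelevant_locus \<Sigma> u" "\<And>f. f \<in> I \<Longrightarrow> cox_eval f x = 0"
  obtains h where "h \<in> graded_piece u \<alpha>" "cox_eval h x \<noteq> 0"
proof -
  have "cox_map \<Sigma> u x \<in> var_of_ideal \<Sigma> u I" by (rule cox_map_in_var_of_ideal[OF assms(2,3)])
  moreover from this have "cox_map \<Sigma> u x \<in> toric_variety \<Sigma>" by (simp add: var_of_ideal_def)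
  ultimately obtain h where "h \<in> graded_piece u \<alpha>" "cox_map \<Sigma> u x \<notin> var_of_section \<Sigma> u h"
    using assms(1) by (auto simp: basepoint_free_def basepoint_def)
  then show thesis
    using that assms(2) \<open>cox_map \<Sigma> u x \<in> toric_variety \<Sigma>\<close>
    by (auto simp: var_of_section_def cox_fiber_def)
qed

text \<open>Two sections that are nonzero throughout the fiber have a product with the same
  property.\<close>

lemma basepoint_free_add:
  assumes "basepoint_free \<Sigma> u I \<alpha>" "basepoint_free \<Sigma> u I \<beta>"
  shows "basepoint_free \<Sigma> u I (\<alpha> \<otimes>\<^bsub>class_group u\<^esub> \<beta>)"
  unfolding basepoint_free_def
proof
  fix \<zeta> assume \<zeta>: "\<zeta> \<in> var_of_ideal \<Sigma> u I"
  then have X: "\<zeta> \<in> toric_variety \<Sigma>" by (simp add: var_of_ideal_def)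
  obtain f where f: "f \<in> graded_piece u \<alpha>" "\<zeta> \<notin> var_of_section \<Sigma> u f"
    using assms(1) \<zeta> X by (auto simp: basepoint_free_def basepoint_def)
  obtain g where g: "g \<in> graded_piece u \<beta>" "\<zeta> \<notin> var_of_section \<Sigma> u g"
    using assms(2) \<zeta> X by (auto simp: basepoint_free_def basepoint_def)
  have "\<zeta> \<notin> var_of_section \<Sigma> u (f * g)"
    using f(2) g(2) by (auto simp: var_of_section_def cox_eval_mult)
  then show "\<not> basepoint \<Sigma> u (\<alpha> \<otimes>\<^bsub>class_group u\<^esub> \<beta>) \<zeta>"
    using graded_piece_mult[OF f(1) g(1)] by (auto simp: basepoint_def)
qed

section \<open>Multiplication by a generic section\<close>

text \<open>\<open>h\<close> has to lie in one graded piece, so the primes are avoided as complex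
  subspaces that do not contain this piece.\<close>

lemma exists_nonzerodivisor_section:
  fixes u :: "'k::{finite,linorder} \<Rightarrow> 'n::finite lattice"
  assumes fin: "finite \<Sigma>" and I: "is_ideal I" and bpf: "basepoint_free \<Sigma> u I \<alpha>"
  obtains h where "h \<in> graded_piece u \<alpha>"
    "\<And>f. h * f \<in> ideal_saturation I (irrelevant_ideal \<Sigma> u) \<Longrightarrow>
      f \<in> ideal_saturation I (irrelevant_ideal \<Sigma> u)"
proof -
  let ?J = "ideal_saturation I (irrelevant_ideal \<Sigma> u)"
  have J: "is_ideal ?J" by (rule is_ideal_ideal_saturation[OF I])
  have "\<not> graded_piece u \<alpha> \<subseteq> P" if P: "P \<in> maximal_quotients ?J" for P
  proof -
    obtain f where f: "P = ideal_quotient ?J f" "f \<notin> ?J"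
      using P unfolding maximal_quotients_def by blast
    have prime: "is_prime_ideal P" by (rule is_prime_ideal_maximal_quotient[OF J P])
    \<comment> \<open>If every cone monomial lay in \<open>P\<close>, idempotence of the saturation
      would put \<open>f\<close> into \<open>?J\<close>.\<close>
    obtain \<sigma> where \<sigma>: "\<sigma> \<in> \<Sigma>" "cone_monomial u \<sigma> \<notin> P"
      using ideal_saturation_idem[OF I, of "cone_monomial u ` \<Sigma>" f] fin f
      by (auto simp: irrelevant_ideal_def ideal_quotient_def)
    have "cone_monomial u \<sigma> ^ N \<notin> P" for N
      using \<sigma>(2) prime by (induction N) (auto simp: is_prime_ideal_def)
    then obtain x where x: "\<And>g. g \<in> P \<Longrightarrow> cox_eval g x = 0" "cox_eval (cone_monomial u \<sigma>) x \<noteq> 0"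
      using nullstellensatz[of P] prime unfolding is_prime_ideal_def by metis
    have "cone_monomial u \<sigma> \<in> irrelevant_ideal \<Sigma> u"
      unfolding irrelevant_ideal_def using \<sigma>(1) by (intro self_module.span_base) auto
    then have off: "x \<notin> irrelevant_locus \<Sigma> u" using x(2) by (auto simp: irrelevant_locus_def)
    have "g \<in> P" if "g \<in> I" for g
    proof -
      have "g \<in> ?J" using that subset_ideal_saturation[OF I] by blast
      then show ?thesis
        using self_module.subspace_scale[OF J, of g f]
        by (simp add: f(1) ideal_quotient_def mult.commute)
    qed
    then have "\<And>g. g \<in> I \<Longrightarrow> cox_eval g x = 0" using x(1) by blast
    then obtain h where "h \<in> graded_piece u \<alpha>" "cox_eval h x \<noteq> 0"
      using basepoint_free_section[OF bpf off] by blast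
    then show ?thesis using x(1) by blast
  qed
  moreover have "cox.subspace P" if "P \<in> maximal_quotients ?J" for P
    using is_prime_ideal_maximal_quotient[OF J that] subspace_ideal
    by (auto simp: is_prime_ideal_def)
  ultimately obtain h where "h \<in> graded_piece u \<alpha>" "\<forall>P\<in>maximal_quotients ?J. h \<notin> P"
    using cox.exists_avoiding_subspaces[OF infinite_UNIV_char_0
        finite_maximal_quotients[OF J] subspace_graded_piece[of u \<alpha>]]
    by blast
  then show thesis
    using that zero_divisor_in_maximal_quotient[OF J] by metis
qed

section \<open>Comparing dimensions of quotient spaces\<close>

lemma (in vector_space) quot_dim_attained:
  assumes "quot_dim V W = enat d"
  obtains F where "finite F" "F \<subseteq> V" "indep_mod W F" "card F = d"
proof -
  let ?A = "{enat (card F) | F. finite F \<and> F \<subseteq> V \<and> indep_mod W F}"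
  have sup: "Sup ?A = enat d" using assms by (simp add: quot_dim_def)
  \<comment> \<open>The empty family makes \<open>?A\<close> nonempty and the bound \<open>d\<close>
    makes it finite, so its supremum is a maximum.\<close>
  have "?A \<noteq> {}"
    by (auto simp: indep_mod_def intro!: exI[of _ "{}"])
  moreover have "?A \<subseteq> enat ` {..d}"
  proof
    fix a assume a: "a \<in> ?A"
    then have "a \<le> enat d" unfolding sup[symmetric] by (rule Sup_upper)
    then show "a \<in> enat ` {..d}" using a by auto
  qed
  then have "finite ?A" by (rule finite_subset) simp
  ultimately have "Max ?A \<in> ?A" "Max ?A = enat d"
    using Max_in[of ?A] Max_Sup[of ?A] sup by simp_all
  then have "enat d \<in> ?A" by metis
  then show thesis using that by auto
qed

lemma (in vector_space) card_le_quot_dim: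
  assumes "finite F" "F \<subseteq> V" "indep_mod W F"
  shows "enat (card F) \<le> quot_dim V W"
  unfolding quot_dim_def using assms by (intro Sup_upper) blast

text \<open>
  A vector of the saturation outside \<open>I\<close> would remain independent of the image of a basis of
  \<open>S\<^sub>\<alpha>\<close> modulo the saturation, so the Hilbert function would increase.
\<close>

lemma saturated_in_degree:
  fixes u :: "'k::{finite,linorder} \<Rightarrow> 'n::finite lattice" and J :: "'k cox set"
  assumes I: "is_ideal I" and J: "is_ideal J" and IJ: "I \<subseteq> J"
    and h: "h \<in> graded_piece u \<beta>" "\<And>f. h * f \<in> J \<Longrightarrow> f \<in> J"
    and sat: "I \<inter> graded_piece u \<alpha> = J \<inter> graded_piece u \<alpha>"
    and hf: "hilbert_function u I \<alpha> = enat d"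
    and hf': "hilbert_function u I (\<alpha> \<otimes>\<^bsub>class_group u\<^esub> \<beta>) = enat d"
  shows "I \<inter> graded_piece u (\<alpha> \<otimes>\<^bsub>class_group u\<^esub> \<beta>) =
    J \<inter> graded_piece u (\<alpha> \<otimes>\<^bsub>class_group u\<^esub> \<beta>)"
proof (rule ccontr)
  let ?V = "graded_piece u (\<alpha> \<otimes>\<^bsub>class_group u\<^esub> \<beta>)"
  assume "\<not> ?thesis"
  then obtain g where g: "g \<in> J" "g \<in> ?V" "g \<notin> I" using IJ by blast
  obtain F where F: "finite F" "F \<subseteq> graded_piece u \<alpha>"
    "cox.indep_mod (I \<inter> graded_piece u \<alpha>) F" "card F = d"
    using hf unfolding hilbert_function_def by (rule cox.quot_dim_attained)
  have scale_h: "cox_scale c (h * f) = h * cox_scale c f" for c f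
    by (simp add: cox_scale_def mult.left_commute)
  \<comment> \<open>Cancelling \<open>h\<close> modulo \<open>J\<close> brings the relation back to
    degree \<alpha>, where \<open>I\<close> and \<open>J\<close> agree.\<close>
  have indJ: "\<forall>f\<in>F. c f = 0" if "(\<Sum>f\<in>F. cox_scale (c f) (h * f)) \<in> J" for c
  proof -
    have "h * (\<Sum>f\<in>F. cox_scale (c f) f) \<in> J" using that by (simp add: scale_h sum_distrib_left)
    then have "(\<Sum>f\<in>F. cox_scale (c f) f) \<in> J" by (rule h(2))
    moreover have "(\<Sum>f\<in>F. cox_scale (c f) f) \<in> graded_piece u \<alpha>"
      using F(2) by (intro cox.subspace_sum cox.subspace_scale subspace_graded_piece) auto
    ultimately show ?thesis using F(3) sat unfolding cox.indep_mod_def by blast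
  qed
  \<comment> \<open>Independence concerns sets, so the products must stay distinct. A collision
    would be a relation with coefficients 1 and -1.\<close>
  have inj: "inj_on ((*) h) F"
  proof (rule inj_onI, rule ccontr)
    fix f f' assume ff: "f \<in> F" "f' \<in> F" "h * f = h * f'" "f \<noteq> f'"
    let ?c = "\<lambda>e. if e = f then 1 else if e = f' then - 1 else (0 :: complex)"
    have "(\<Sum>e\<in>F. cox_scale (?c e) (h * e)) = (\<Sum>e\<in>{f, f'}. cox_scale (?c e) (h * e))"
      by (rule sum.mono_neutral_right) (use F(1) ff in auto)
    also have "\<dots> = 0" using ff by simp
    finally have "?c f = 0" using indJ[of ?c] ff(1) self_module.subspace_0[OF J] by metis
    then show False by simp
  qed
  have gF: "g \<notin> (*) h ` F"
  proof
    assume "g \<in> (*) h ` F"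
    then obtain f where f: "f \<in> F" "g = h * f" by blast
    let ?c = "\<lambda>e. if e = f then 1 else (0 :: complex)"
    have "(\<Sum>e\<in>F. cox_scale (?c e) (h * e)) = (\<Sum>e\<in>{f}. cox_scale (?c e) (h * e))"
      by (rule sum.mono_neutral_right) (use F(1) f in auto)
    also have "\<dots> = g" using f(2) by simp
    finally have "\<forall>e\<in>F. ?c e = 0" using g(1) by (intro indJ) metis
    then show False using f(1) by auto
  qed
  have "cox.indep_mod (I \<inter> ?V) (insert g ((*) h ` F))"
    unfolding cox.indep_mod_def
  proof (intro allI impI)
    fix c assume "(\<Sum>f\<in>insert g ((*) h ` F). cox_scale (c f) f) \<in> I \<inter> ?V"
    then have s: "cox_scale (c g) g + (\<Sum>f\<in>F. cox_scale (c (h * f)) (h * f)) \<in> I"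
      using F(1) gF inj by (simp add: sum.reindex)
    \<comment> \<open>As \<open>g\<close> lies in \<open>J\<close>, dropping its term leaves a
      relation to which \<open>indJ\<close> applies. Then only the multiple of \<open>g\<close> is
      left, and \<open>g\<close> is outside \<open>I\<close>.\<close>
    have "cox_scale (c g) g \<in> J" by (rule cox.subspace_scale[OF subspace_ideal[OF J] g(1)])
    then have "(\<Sum>f\<in>F. cox_scale (c (h * f)) (h * f)) \<in> J"
      using self_module.subspace_diff[OF J subsetD[OF IJ s]] by fastforce
    then have c0: "\<forall>f\<in>F. c (h * f) = 0" by (rule indJ)
    then have "cox_scale (c g) g \<in> I" using s by simp
    then have "c g = 0"
      using cox.subspace_scale[OF subspace_ideal[OF I], of "cox_scale (c g) g" "inverse (c g)"] g(3)
      by (cases "c g = 0") auto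
    then show "\<forall>f\<in>insert g ((*) h ` F). c f = 0" using c0 by blast
  qed
  moreover have "insert g ((*) h ` F) \<subseteq> ?V"
    using g(2) graded_piece_mult[OF _ h(1)] F(2) by (auto simp: mult.commute[of h])
  \<comment> \<open>This family has \<open>d + 1\<close> members, one more than the dimension
    allows.\<close>
  ultimately have "enat (card (insert g ((*) h ` F))) \<le>
      hilbert_function u I (\<alpha> \<otimes>\<^bsub>class_group u\<^esub> \<beta>)"
    unfolding hilbert_function_def using F(1) by (intro cox.card_le_quot_dim) auto
  then show False using gF F(1,4) card_image[OF inj] hf' by simp
qed

theorem theorem4p2:
  fixes \<Sigma> :: "(real ^ 'n::{finite,linorder}) set set"
    and u :: "'k::{finite,linorder} \<Rightarrow> 'n lattice"
    and I :: "'k cox set"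
    and \<delta> :: nat
    and \<alpha> \<alpha>\<^sub>0 :: "('k \<Rightarrow>\<^sub>0 int) set"
  assumes "complete_fan \<Sigma>"
    and "ray_generators \<Sigma> u"
    and "homogeneous_ideal u I"
    and "zero_dimensional \<Sigma> u I"
    and "scheme_degree \<Sigma> u I = enat \<delta>"
    and "\<alpha> \<in> regularity \<Sigma> u I"
    and "\<alpha>\<^sub>0 \<in> effective_classes u"
    and "basepoint_free \<Sigma> u I \<alpha>\<^sub>0"
    and "hilbert_function u I (\<alpha> \<otimes>\<^bsub>class_group u\<^esub> \<alpha>\<^sub>0) = enat \<delta>"
  shows "regularity_pair \<Sigma> u I \<alpha> \<alpha>\<^sub>0"
proof -
  let ?J = "ideal_saturation I (irrelevant_ideal \<Sigma> u)"
  have fin: "finite \<Sigma>" using assms(1) by (simp add: complete_fan_def fan_def)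
  have I: "is_ideal I" using assms(3) by (simp add: homogeneous_ideal_def)
  have \<alpha>: "\<alpha> \<in> carrier (class_group u)" "hilbert_function u I \<alpha> = enat \<delta>"
    "I \<inter> graded_piece u \<alpha> = ?J \<inter> graded_piece u \<alpha>" "basepoint_free \<Sigma> u I \<alpha>"
    using assms(5,6) by (simp_all add: regularity_def)
  have \<alpha>\<^sub>0: "\<alpha>\<^sub>0 \<in> carrier (class_group u)"
    using assms(7) divisor_class_in_carrier by (auto simp: effective_classes_def)
  obtain h where h: "h \<in> graded_piece u \<alpha>\<^sub>0" "\<And>f. h * f \<in> ?J \<Longrightarrow> f \<in> ?J"
    using exists_nonzerodivisor_section[OF fin I assms(8)] by blast
  have "I \<inter> graded_piece u (\<alpha> \<otimes>\<^bsub>class_group u\<^esub> \<alpha>\<^sub>0) =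
      ?J \<inter> graded_piece u (\<alpha> \<otimes>\<^bsub>class_group u\<^esub> \<alpha>\<^sub>0)"
    using saturated_in_degree[OF I is_ideal_ideal_saturation[OF I]
        subset_ideal_saturation[OF I] h \<alpha>(3,2) assms(9)] .
  moreover have "\<alpha> \<otimes>\<^bsub>class_group u\<^esub> \<alpha>\<^sub>0 \<in> carrier (class_group u)"
    using group_class_group \<alpha>(1) \<alpha>\<^sub>0 by (metis group.is_monoid monoid.m_closed)
  ultimately show ?thesis
    using assms(5,6,8,9) \<alpha>(1,4) \<alpha>\<^sub>0 basepoint_free_add[OF \<alpha>(4) assms(8)]
    by (simp add: regularity_pair_def regularity_def)
qed

end
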